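(* Let $r\in[2,\infty)$ and let $(\gamma_j)_{j\in\mathbb{N}}$ be a sequence of (real or complex) subgaussian random variables with $s=\sup_j\mathrm{sg}(\gamma_j)<\infty$ and, if $r>2$, also $M=\sup_j\|\gamma_j\|_\infty<\infty$. Then there is a constant $C_r>0$, depending only on $s$ if $r=2$ and only on $r,s,M$ if $r>2$, such that for any finite set $A\subset\mathbb{N}$ and any choice of finitely many Dirichlet polynomials $D_1,\dots,D_K\in\mathcal{D}_A$, $$\Big\|\sup_{t\in\mathbb{R}}\Big|\sum_{j=1}^K\gamma_jD_j(t)\Big|\Big\|_{L_{\varphi_r}}\le C_r\Big(1+\Pi(A)\big(1+20\log\Omega(A)\big)\Big)^{\frac1r}\sup_{t\in\mathbb{R}}\big\|(D_j(t))_{j=1}^K\big\|_{S_{r'}}.$$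
   Context: A real random variable $f$ is subgaussian if there is $s\ge0$ with $\mathbb{E}\exp(xf)\le\exp(s^2x^2/2)$ for all $x\in\mathbb{R}$; a complex random variable $f$ is subgaussian if there is $s\ge0$ with $\mathbb{E}\exp(\mathrm{Re}(zf))\le\exp(s^2|z|^2/2)$ for all $z\in\mathbb{C}$. The best such $s$ is denoted $\mathrm{sg}(f)$. All $\gamma_j$ live on a probability space with measure $\mathbb{P}$. For $1\le r<\infty$ let $\varphi_r(t)=e^{t^r}-1$ and $\|f\|_{L_{\varphi_r}}=\inf\{\varepsilon>0:\int\varphi_r(|f|/\varepsilon)\,d\mathbb{P}\le1\}$. With $1/r+1/r'=1$: $S_{r'}=\ell_2$ if $r=2$, and $S_{r'}=\ell_{r',\infty}$ with $\|x\|_{\ell_{r',\infty}}=\sup_k k^{1/r'}x_k^*$ if $r\in(2,\infty)$, where $(x_k^* )$ is the decreasing rearrangement of $(|x_k|)$. For finite $A\subset\mathbb{N}$, $\mathcal{D}_A$ is the space of Dirichlet polynomials $D(s)=\sum_{n\in A}a_nn^{-s}$ with complex $a_n$; for $t\in\mathbb{R}$, $D(t)$ in the statement denotes the value on the imaginary axis, $\sum_{n\in A}a_nn^{-it}$. $\pi(n)$ is the number of primes $\le n$, $\Omega(n)$ is the number of prime divisors of $n$ counted with multiplicity, $\Pi(A):=\max_{n\in A}\pi(n)$, $\Omega(A):=\max_{n\in A}\Omega(n)$.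
   Formalization: The random variables γ_j are assumed independent (the claim fails if all γ_j equal one Rademacher variable), and the constant is formally chosen per underlying set of the probability space; passing to the joint law of (γ_j) gives one constant for all spaces. *)

theory Defs
  imports "HOL-Probability.Probability" "HOL-Computational_Algebra.Computational_Algebra"
begin

text \<open>
  Expectations of nonnegative functions are Lebesgue integrals with values in the extended
  nonnegative reals, so that the bounds below include integrability of the exponentials.
\<close>

definition real_subgaussian_bound :: "'a measure \<Rightarrow> real \<Rightarrow> ('a \<Rightarrow> real) \<Rightarrow> bool" where
  "real_subgaussian_bound P s f \<longleftrightarrow> 0 \<le> s \<and>
     (\<forall>x. (\<integral>\<^sup>+ \<omega>. ennreal (exp (x * f \<omega>)) \<partial>P) \<le> ennreal (exp (s\<^sup>2 * x\<^sup>2 / 2)))"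

definition real_subgaussian :: "'a measure \<Rightarrow> ('a \<Rightarrow> real) \<Rightarrow> bool" where
  "real_subgaussian P f \<longleftrightarrow> f \<in> borel_measurable P \<and> (\<exists>s. real_subgaussian_bound P s f)"

definition real_sg :: "'a measure \<Rightarrow> ('a \<Rightarrow> real) \<Rightarrow> real" where
  "real_sg P f = Inf {s. real_subgaussian_bound P s f}"

definition complex_subgaussian_bound :: "'a measure \<Rightarrow> real \<Rightarrow> ('a \<Rightarrow> complex) \<Rightarrow> bool" where
  "complex_subgaussian_bound P s f \<longleftrightarrow> 0 \<le> s \<and>
     (\<forall>z. (\<integral>\<^sup>+ \<omega>. ennreal (exp (Re (z * f \<omega>))) \<partial>P) \<le> ennreal (exp (s\<^sup>2 * (cmod z)\<^sup>2 / 2)))"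

definition complex_subgaussian :: "'a measure \<Rightarrow> ('a \<Rightarrow> complex) \<Rightarrow> bool" where
  "complex_subgaussian P f \<longleftrightarrow> f \<in> borel_measurable P \<and> (\<exists>s. complex_subgaussian_bound P s f)"

definition complex_sg :: "'a measure \<Rightarrow> ('a \<Rightarrow> complex) \<Rightarrow> real" where
  "complex_sg P f = Inf {s. complex_subgaussian_bound P s f}"

definition orlicz_exp :: "real \<Rightarrow> real \<Rightarrow> real" where
  "orlicz_exp r t = exp (t powr r) - 1"

text \<open>The value is \<open>\<infinity>\<close> if no \<open>\<epsilon>\<close> is admissible.\<close>

definition luxemburg_norm :: "'a measure \<Rightarrow> real \<Rightarrow> ('a \<Rightarrow> real) \<Rightarrow> ennreal" where
  "luxemburg_norm P r f =
     Inf {ennreal \<epsilon> | \<epsilon>. \<epsilon> > 0 \<and> (\<integral>\<^sup>+ \<omega>. ennreal (orlicz_exp r (\<bar>f \<omega>\<bar> / \<epsilon>)) \<partial>P) \<le> 1}"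

text \<open>
  The \<open>k\<close>-th largest modulus of \<open>x\<close>, for \<open>k \<ge> 1\<close>, with repetitions: the generalized inverse of
  the distribution function of \<open>x\<close>. The terms of \<open>x\<close> are indexed from \<open>0\<close>, those of the
  rearrangement from \<open>1\<close>.
\<close>

definition decreasing_rearrangement :: "(nat \<Rightarrow> complex) \<Rightarrow> nat \<Rightarrow> real" where
  "decreasing_rearrangement x k =
     Inf {\<sigma>. 0 \<le> \<sigma> \<and> finite {j. cmod (x j) > \<sigma>} \<and> card {j. cmod (x j) > \<sigma>} < k}"

definition weak_lp_norm :: "real \<Rightarrow> (nat \<Rightarrow> complex) \<Rightarrow> real" where
  "weak_lp_norm p x = (SUP k\<in>{1..}. real k powr (1 / p) * decreasing_rearrangement x k)"

definition l2_norm :: "(nat \<Rightarrow> complex) \<Rightarrow> real" where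
  "l2_norm x = sqrt (\<Sum>j. (cmod (x j))\<^sup>2)"

definition conj_exponent :: "real \<Rightarrow> real" where
  "conj_exponent r = r / (r - 1)"

text \<open>Both norms are used for finitely supported sequences only, where they are finite.\<close>

definition S_norm :: "real \<Rightarrow> (nat \<Rightarrow> complex) \<Rightarrow> real" where
  "S_norm p x = (if p = 2 then l2_norm x else weak_lp_norm p x)"

definition dirichlet_polys :: "nat set \<Rightarrow> (complex \<Rightarrow> complex) set" where
  "dirichlet_polys A = {D. \<exists>a. D = (\<lambda>s. \<Sum>n\<in>A. a n * of_nat n powr (- s))}"

definition prime_counting :: "nat \<Rightarrow> nat" where
  "prime_counting n = card {p. prime p \<and> p \<le> n}"

definition big_omega :: "nat \<Rightarrow> nat" where
  "big_omega n = size (prime_factorization n)"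

text \<open>On \<^typ>\<open>nat\<close> the supremum of a finite nonempty set is its maximum; that of \<open>{}\<close> is \<open>0\<close>.\<close>

definition prime_counting_set :: "nat set \<Rightarrow> nat" where
  "prime_counting_set A = (SUP n\<in>A. prime_counting n)"

definition big_omega_set :: "nat set \<Rightarrow> nat" where
  "big_omega_set A = (SUP n\<in>A. big_omega n)"

text \<open>
  The random variables \<open>\<gamma> j\<close> are all real or all complex; real ones are regarded as complex-valued
  functions. The number \<open>s\<close> is the supremum of their subgaussian constants.
  Independence is not part of this definition, but it cannot be dropped in Kahane-Salem-Zygmund
  inequalities: if all \<open>\<gamma> j\<close> are equal to one Rademacher variable, then the sum of \<open>\<gamma> j\<close> over
  \<open>j < K\<close> has Luxemburg norm proportional to \<open>K\<close>, while the \<open>K\<close>-tuple \<open>(1, \<dots>, 1)\<close> has norm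
  \<open>K powr (1 - 1 / r)\<close>.
\<close>

definition subgaussian_sequence :: "'a measure \<Rightarrow> (nat \<Rightarrow> 'a \<Rightarrow> complex) \<Rightarrow> real \<Rightarrow> bool" where
  "subgaussian_sequence P \<gamma> s \<longleftrightarrow>
     (\<exists>g. (\<forall>j \<omega>. \<gamma> j \<omega> = complex_of_real (g j \<omega>)) \<and>
          (\<forall>j. real_subgaussian P (g j)) \<and>
          bdd_above (range (\<lambda>j. real_sg P (g j))) \<and> s = (SUP j. real_sg P (g j))) \<or>
     ((\<forall>j. complex_subgaussian P (\<gamma> j)) \<and>
      bdd_above (range (\<lambda>j. complex_sg P (\<gamma> j))) \<and> s = (SUP j. complex_sg P (\<gamma> j)))"

end

theory Submission
  imports Defs
    "HOL-Complex_Analysis.Conformal_Mappings"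
    "HOL-Analysis.Kronecker_Approximation_Theorem"
begin

text \<open>
  Through \<open>n \<mapsto> \<Prod>p. z\<^sub>p\<close> (the product over the prime factors of \<open>n\<close>), a Dirichlet polynomial
  in \<open>\<D>\<^sub>A\<close> becomes a polynomial of degree at most \<open>m = \<Omega>(A)\<close> in \<open>N = \<Pi>(A)\<close> variables, and by
  Kronecker's theorem its supremum on the imaginary axis is the one on the torus. The maximum
  principle on a polydisc of radius \<open>1 + 1/m\<close> and Cauchy's inequality give a Lipschitz bound of order
  \<open>m\<close>, so the supremum is at most twice the maximum over a set of \<open>(80 m)\<^sup>N\<close> points \<open>t\<close> that depends
  only on \<open>A\<close>. For fixed \<open>t\<close>, subgaussian tails (and, if \<open>r > 2\<close>, splitting off the \<open>k\<close> largest
  coefficients at level \<open>k\<^bsup>1/r\<^esup>\<close>) bound the exponential moment of the random sum, and the maximum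
  over the points costs a factor of order \<open>(1 + log (80 m)\<^sup>N)\<^bsup>1/r\<^esup>\<close>.
\<close>

subsection \<open>Polynomials on the torus\<close>

text \<open>The random coefficients change with \<open>\<omega>\<close>, so the points for the union
  bound must be fixed before the polynomial. They lie on the line, one for each occupied cell of a
  grid on the torus. Kronecker's theorem does not produce them; it only carries a bound from the
  line to the whole torus, where the maximum principle needs it. The Lipschitz constant then
  involves the degree and not the frequencies \<open>ln n\<close>. Passing from the points to the
  line costs half of the unknown supremum itself; being finite, this can be absorbed, whence the
  factor 2. For \<open>r > 2\<close> the desired tail \<open>exp (- 2 * k)\<close> at level
  \<open>k powr (1 / r)\<close> is lighter than a Gaussian one, so a subgaussian bound on the whole
  sum is not enough. The decay \<open>i powr (1 / r - 1)\<close> of the coefficients balances the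
  two parts: the large ones add up to order \<open>k powr (1 / r)\<close>, and the others have l2
  norm of order \<open>k powr (1 / r - 1 / 2)\<close>, which a deviation of order
  \<open>sqrt k\<close> turns into the same power.\<close>

definition monomial_sum ::
    "('b \<Rightarrow> complex) \<Rightarrow> ('b \<Rightarrow> 'c multiset) \<Rightarrow> 'b set \<Rightarrow> ('c \<Rightarrow> complex) \<Rightarrow> complex" where
  "monomial_sum a F A z = (\<Sum>n\<in>A. a n * (\<Prod>p\<in>#F n. z p))"

lemma prod_mset_scale:
  fixes c :: "'a :: comm_monoid_mult"
  shows "(\<Prod>p\<in>#M. c * z p) = c ^ size M * (\<Prod>p\<in>#M. z p)"
  by (induction M) (simp_all add: ac_simps)

lemma holomorphic_on_prod_mset:
  assumes "\<And>p. f p holomorphic_on U"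
  shows "(\<lambda>x. \<Prod>p\<in>#M. f p x) holomorphic_on U"
  by (induction M) (auto intro!: holomorphic_intros assms)

lemma holomorphic_on_monomial_sum:
  assumes "\<And>p. f p holomorphic_on U"
  shows "(\<lambda>x. monomial_sum a F A (\<lambda>p. f p x)) holomorphic_on U"
  unfolding monomial_sum_def
  by (intro holomorphic_intros holomorphic_on_prod_mset assms)

text \<open>One variable at a time: the induction runs over the set \<open>T\<close> of variables
  allowed inside the disc. Freeing \<open>q\<close> needs only the one-variable maximum principle,
  because its boundary values fall under the induction hypothesis for \<open>T\<close>.\<close>

lemma monomial_sum_polydisc:
  assumes "finite S"
    and torus: "\<And>z. (\<And>p. p \<in> S \<Longrightarrow> cmod (z p) = 1) \<Longrightarrow> cmod (monomial_sum a F A z) \<le> B"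
    and z: "\<And>p. p \<in> S \<Longrightarrow> cmod (z p) \<le> 1"
  shows "cmod (monomial_sum a F A z) \<le> B"
proof -
  have "cmod (monomial_sum a F A z) \<le> B"
    if "finite T" "T \<subseteq> S" "\<forall>p\<in>T. cmod (z p) \<le> 1" "\<forall>p\<in>S - T. cmod (z p) = 1" for T z
    using that
  proof (induction T arbitrary: z rule: finite_induct)
    case empty
    then show ?case by (intro torus) auto
  next
    case (insert q T)
    define f where "f = (\<lambda>x. monomial_sum a F A (\<lambda>p. if p = q then x else z p))"
    have hol: "f holomorphic_on UNIV" unfolding f_def
    proof (rule holomorphic_on_monomial_sum)
      show "(\<lambda>x. if p = q then x else z p) holomorphic_on UNIV" for p
        by (cases "p = q") auto
    qed
    have "norm (f (z q)) \<le> B"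
    proof (rule maximum_modulus_frontier[where S = "cball 0 1" and f = f])
      show "f holomorphic_on interior (cball 0 1)"
        using hol holomorphic_on_subset by blast
      show "continuous_on (closure (cball 0 1)) f"
        using hol holomorphic_on_subset holomorphic_on_imp_continuous_on by blast
      show "norm (f x) \<le> B" if "x \<in> frontier (cball 0 1)" for x
        unfolding f_def by (rule insert.IH) (use that insert in auto)
    qed (use insert in auto)
    moreover have "(\<lambda>p. if p = q then z q else z p) = z" by auto
    ultimately show ?case by (simp add: f_def)
  qed
  from this[of S z] assms show ?thesis by auto
qed

text \<open>The maximum principle is applied to the reciprocal polynomial \<open>h\<close> along the complex line through \<open>z\<close>.\<close>

lemma monomial_sum_growth:
  assumes "finite S" and deg: "\<And>n. n \<in> A \<Longrightarrow> size (F n) \<le> m"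
    and torus: "\<And>z. (\<And>p. p \<in> S \<Longrightarrow> cmod (z p) = 1) \<Longrightarrow> cmod (monomial_sum a F A z) \<le> B"
    and R: "R \<ge> 1" and z: "\<And>p. p \<in> S \<Longrightarrow> cmod (z p) \<le> R"
  shows "cmod (monomial_sum a F A z) \<le> R ^ m * B"
proof -
  define u where "u = (\<lambda>p. of_real (1 / R) * z p)"
  define h where "h = (\<lambda>x::complex. \<Sum>n\<in>A. a n * x ^ (m - size (F n)) * (\<Prod>p\<in>#F n. u p))"
  have hol: "h holomorphic_on UNIV" unfolding h_def by (intro holomorphic_intros)
  have h_eq: "h x = x ^ m * monomial_sum a F A (\<lambda>p. inverse x * u p)" if "x \<noteq> 0" for x
    unfolding h_def monomial_sum_def prod_mset_scale sum_distrib_left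
  proof (rule sum.cong)
    fix n assume "n \<in> A"
    then have "x ^ m = x ^ (m - size (F n)) * x ^ size (F n)"
      using deg by (simp flip: power_add)
    then show "a n * x ^ (m - size (F n)) * (\<Prod>p\<in>#F n. u p)
        = x ^ m * (a n * (inverse x ^ size (F n) * (\<Prod>p\<in>#F n. u p)))"
      using that by (simp add: field_simps)
  qed simp
  have "norm (h (of_real (1 / R))) \<le> B"
  proof (rule maximum_modulus_frontier[where S = "cball 0 1" and f = h])
    show "h holomorphic_on interior (cball 0 1)"
      using hol holomorphic_on_subset by blast
    show "continuous_on (closure (cball 0 1)) h"
      using hol holomorphic_on_subset holomorphic_on_imp_continuous_on by blast
    show "norm (h x) \<le> B" if "x \<in> frontier (cball 0 1)" for x
    proof -
      have x: "norm x = 1" using that by auto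
      then have "x \<noteq> 0" by auto
      have "norm (monomial_sum a F A (\<lambda>p. inverse x * u p)) \<le> B"
        by (rule monomial_sum_polydisc[OF \<open>finite S\<close> torus])
           (use x z R in \<open>auto simp: u_def norm_mult norm_inverse norm_divide\<close>)
      then show ?thesis using h_eq[OF \<open>x \<noteq> 0\<close>] x by (simp add: norm_mult norm_power)
    qed
    show "complex_of_real (1 / R) \<in> cball 0 1" using R by (simp add: norm_divide)
  qed auto
  moreover have "(\<lambda>p. inverse (complex_of_real (1 / R)) * u p) = z"
    using R by (auto simp: u_def)
  ultimately have "norm ((1 / R) ^ m * monomial_sum a F A z) \<le> B"
    using h_eq[of "of_real (1 / R)"] R by (simp add: divide_inverse)
  then show ?thesis
    using R by (simp add: norm_mult norm_power norm_divide field_simps)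
qed

text \<open>Along the complex line through \<open>w\<close> and \<open>z\<close> this is a
  one-variable estimate, so the number of variables does not enter. Up to radius
  \<open>1 / m\<close> the values are at most \<open>3 * B\<close>; Cauchy's inequality with radius
  \<open>1 / (2 * m)\<close> bounds the derivative by \<open>6 * B * m\<close>, and a step of
  \<open>1 / (12 * m)\<close> costs \<open>B / 2\<close>.\<close>

lemma monomial_sum_close:
  assumes "finite S" and deg: "\<And>n. n \<in> A \<Longrightarrow> size (F n) \<le> m" and "m \<ge> 1"
    and torus: "\<And>z. (\<And>p. p \<in> S \<Longrightarrow> cmod (z p) = 1) \<Longrightarrow> cmod (monomial_sum a F A z) \<le> B"
    and w: "\<And>p. p \<in> S \<Longrightarrow> cmod (w p) = 1"
    and close: "\<And>p. p \<in> S \<Longrightarrow> cmod (z p - w p) \<le> 1 / (12 * m)"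
  shows "cmod (monomial_sum a F A z - monomial_sum a F A w) \<le> B / 2"
proof -
  have B: "B \<ge> 0" using torus[of "\<lambda>_. 1"] by (meson norm_ge_zero norm_one order_trans)
  \<comment> \<open>Scaled so that \<open>cmod (v p) \<le> 1\<close>, with \<open>w\<close> at
    parameter 0 and \<open>z\<close> at parameter \<open>1 / (12 * m)\<close>.\<close>
  define v where "v = (\<lambda>p. of_nat (12 * m) * (z p - w p))"
  define g where "g = (\<lambda>x. monomial_sum a F A (\<lambda>p. w p + x * v p))"
  have v: "cmod (v p) \<le> 1" if "p \<in> S" for p
    using close[OF that] \<open>m \<ge> 1\<close> by (simp add: v_def norm_mult pos_le_divide_eq mult.commute)
  have hol: "g holomorphic_on UNIV" unfolding g_def
    by (intro holomorphic_on_monomial_sum holomorphic_intros)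
  have g_le: "cmod (g x) \<le> 3 * B" if "cmod x \<le> 1 / m" for x
  proof -
    have "cmod (g x) \<le> (1 + 1 / m) ^ m * B"
      unfolding g_def
    proof (rule monomial_sum_growth[OF \<open>finite S\<close> deg torus])
      fix p assume p: "p \<in> S"
      have "cmod (w p + x * v p) \<le> cmod (w p) + cmod x * cmod (v p)"
        by (metis norm_mult norm_triangle_ineq)
      also have "\<dots> \<le> 1 + (1 / m) * 1"
        using w[OF p] v[OF p] that by (intro add_mono mult_mono) auto
      finally show "cmod (w p + x * v p) \<le> 1 + 1 / m" by simp
    qed auto
    \<comment> \<open>This is why the radius exceeds 1 by just \<open>1 / m\<close>: the growth
      factor is bounded whatever the degree.\<close>
    also have "(1 + 1 / m) ^ m \<le> exp 1"
      using exp_ge_one_plus_x_over_n_power_n[of m 1] \<open>m \<ge> 1\<close> by simp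
    also have "exp 1 \<le> (3::real)" by (rule exp_le)
    finally show ?thesis using B by (simp add: mult_right_mono)
  qed
  have deriv_le: "cmod (deriv g x) \<le> 6 * B * m" if "x \<in> cball 0 (1 / (12 * m))" for x
  proof -
    have "cmod ((deriv ^^ 1) g x) \<le> fact 1 * (3 * B) / (1 / (2 * m)) ^ 1"
    proof (rule Cauchy_inequality)
      show "g holomorphic_on ball x (1 / (2 * m))" using hol holomorphic_on_subset by blast
      show "continuous_on (cball x (1 / (2 * m))) g"
        using hol holomorphic_on_subset holomorphic_on_imp_continuous_on by blast
      show "norm (g y) \<le> 3 * B" if y: "norm (x - y) = 1 / (2 * m)" for y
      proof (rule g_le)
        have "cmod y \<le> cmod x + cmod (x - y)"
          by (metis norm_minus_commute norm_triangle_sub)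
        also have "\<dots> \<le> 1 / (12 * m) + 1 / (2 * m)" using y \<open>x \<in> _\<close> by simp
        also have "\<dots> \<le> 1 / m" using \<open>m \<ge> 1\<close> by (simp add: field_simps)
        finally show "cmod y \<le> 1 / m" .
      qed
    qed (use \<open>m \<ge> 1\<close> in auto)
    then show ?thesis by (simp add: field_simps)
  qed
  have "norm (g (1 / (12 * m)) - g 0) \<le> 6 * B * m * norm (complex_of_real (1 / (12 * m)) - 0)"
  proof (rule field_differentiable_bound[where S = "cball 0 (1 / (12 * m))" and f = g and f' = "deriv g"])
    show "(g has_field_derivative deriv g x) (at x within cball 0 (1 / (12 * m)))" for x
      using hol by (meson has_field_derivative_at_within holomorphic_derivI iso_tuple_UNIV_I open_UNIV)
  qed (use deriv_le in \<open>auto simp: norm_divide norm_mult\<close>)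
  also have "\<dots> = B / 2" using \<open>m \<ge> 1\<close> by (simp add: norm_divide norm_mult)
  also have "g (1 / (12 * m)) = monomial_sum a F A z"
    using \<open>m \<ge> 1\<close> by (simp add: g_def v_def)
  also have "g 0 = monomial_sum a F A w" by (simp add: g_def)
  finally show ?thesis .
qed

subsection \<open>Dirichlet polynomials on the imaginary axis\<close>

lemma cmod_exp_ii_diff_le: "cmod (exp (\<i> * of_real x) - exp (\<i> * of_real y)) \<le> \<bar>x - y\<bar>"
proof -
  have "exp (\<i> * of_real x) - exp (\<i> * of_real y) = exp (\<i> * of_real y) * (exp (\<i> * of_real (x - y)) - 1)"
    by (simp add: algebra_simps flip: exp_add)
  then have "cmod (exp (\<i> * of_real x) - exp (\<i> * of_real y)) = cmod (exp (\<i> * of_real (x - y)) - 1)"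
    by (simp add: norm_mult)
  also have "\<dots> \<le> \<bar>x - y\<bar>" using iexp_approx1[of "x - y" 0] by simp
  finally show ?thesis .
qed

text \<open>Pigeonhole on a grid with \<open>L\<close> cells per coordinate; \<open>inv k\<close>
  picks one parameter from each occupied cell, so the net consists of parameters and not of grid
  points.\<close>

lemma exists_frac_net:
  fixes x :: "'d \<Rightarrow> 'c \<Rightarrow> real"
  assumes "finite S" and "L > 0"
  obtains F where "finite F" "card F \<le> L ^ card S"
    "\<And>t. \<exists>t'\<in>F. \<forall>p\<in>S. \<bar>frac (x t p) - frac (x t' p)\<bar> \<le> 1 / real L"
proof -
  define k where "k = (\<lambda>t. \<lambda>p\<in>S. nat \<lfloor>L * frac (x t p)\<rfloor>)"
  have sub: "range k \<subseteq> S \<rightarrow>\<^sub>E {..<L}"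
  proof safe
    fix t p assume "p \<in> S"
    have "real L * frac (x t p) < real L" using \<open>L > 0\<close> by (simp add: frac_lt_1)
    moreover have "0 \<le> real L * frac (x t p)" by simp
    ultimately have "\<lfloor>real L * frac (x t p)\<rfloor> < int L" by linarith
    then show "k t p < L" using \<open>p \<in> S\<close> \<open>L > 0\<close> by (simp add: k_def nat_less_iff)
  qed (auto simp: k_def)
  have fin: "finite (range k)" using sub \<open>finite S\<close> by (meson finite_PiE finite_lessThan finite_subset)
  have card: "card (range k) \<le> L ^ card S"
    using card_mono[OF _ sub] \<open>finite S\<close> by (simp add: card_PiE finite_PiE)
  show ?thesis
  proof
    show "finite (inv k ` range k)" using fin by simp
    show "card (inv k ` range k) \<le> L ^ card S" using card card_image_le[OF fin] le_trans by blast
    fix t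
    have eq: "k (inv k (k t)) = k t" by (simp add: f_inv_into_f)
    have "\<bar>frac (x t p) - frac (x (inv k (k t)) p)\<bar> \<le> 1 / real L" if "p \<in> S" for p
    proof -
      have "nat \<lfloor>L * frac (x t p)\<rfloor> = nat \<lfloor>L * frac (x (inv k (k t)) p)\<rfloor>"
        using fun_cong[OF eq, of p] that by (simp add: k_def)
      then have "\<lfloor>L * frac (x t p)\<rfloor> = \<lfloor>L * frac (x (inv k (k t)) p)\<rfloor>"
        by (simp add: nat_eq_iff split: if_splits)
      then have "\<bar>L * frac (x t p) - L * frac (x (inv k (k t)) p)\<bar> \<le> 1" by linarith
      then have "L * \<bar>frac (x t p) - frac (x (inv k (k t)) p)\<bar> \<le> 1"
        by (simp add: abs_mult flip: right_diff_distrib)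
      then show ?thesis using \<open>L > 0\<close> by (simp add: field_simps)
    qed
    then show "\<exists>t'\<in>inv k ` range k. \<forall>p\<in>S. \<bar>frac (x t p) - frac (x t' p)\<bar> \<le> 1 / real L"
      by blast
  qed
qed

section \<open>Density of the prime flow in the torus\<close>

lemma ln_primes_int_independent:
  fixes u :: "nat \<Rightarrow> int"
  assumes "finite S" "\<And>p. p \<in> S \<Longrightarrow> prime p" "(\<Sum>p\<in>S. of_int (u p) * ln (real p)) = 0" "q \<in> S"
  shows "u q = 0"
proof -
  have pos: "real p > 0" if "p \<in> S" for p using assms(2)[OF that] prime_gt_0_nat by simp
  have ln_prod': "ln (real (\<Prod>p\<in>S. p ^ f p)) = (\<Sum>p\<in>S. real (f p) * ln (real p))" for f
  proof -
    have "ln (\<Prod>p\<in>S. real p ^ f p) = (\<Sum>p\<in>S. ln (real p ^ f p))"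
      using pos assms(1) by (intro ln_prod) auto
    then show ?thesis using pos by (simp add: ln_realpow)
  qed
  \<comment> \<open>The positive and negative parts of \<open>u\<close> are the exponents of two
    natural numbers. The vanishing combination of logarithms makes these equal, and unique
    factorization compares the exponents of \<open>q\<close>.\<close>
  have "ln (real (\<Prod>p\<in>S. p ^ nat (u p))) - ln (real (\<Prod>p\<in>S. p ^ nat (- u p)))
      = (\<Sum>p\<in>S. of_int (u p) * ln (real p))"
    unfolding ln_prod' sum_subtractf[symmetric]
  proof (rule sum.cong)
    fix p
    have "real (nat (u p)) - real (nat (- u p)) = of_int (u p)" by linarith
    then show "real (nat (u p)) * ln (real p) - real (nat (- u p)) * ln (real p) = of_int (u p) * ln (real p)"
      by (simp flip: left_diff_distrib)
  qed simp
  then have "ln (real (\<Prod>p\<in>S. p ^ nat (u p))) = ln (real (\<Prod>p\<in>S. p ^ nat (- u p)))"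
    using assms by simp
  then have "real (\<Prod>p\<in>S. p ^ nat (u p)) = real (\<Prod>p\<in>S. p ^ nat (- u p))"
    using pos by (subst (asm) ln_inj_iff) (auto intro!: prod_pos)
  then have "(\<Prod>p\<in>S. p ^ nat (u p)) = (\<Prod>p\<in>S. p ^ nat (- u p))"
    by (simp only: of_nat_eq_iff)
  then have "multiplicity q (\<Prod>p\<in>S. p ^ nat (u p)) = multiplicity q (\<Prod>p\<in>S. p ^ nat (- u p))"
    by simp
  then have "nat (u q) = nat (- u q)"
    using assms by (simp add: multiplicity_prod_prime_powers)
  then show ?thesis by linarith
qed

definition prime_flow :: "real \<Rightarrow> nat \<Rightarrow> complex" where
  "prime_flow t p = exp (\<i> * of_real (- t * ln (real p)))"

text \<open>Kronecker's theorem for the frequencies \<open>\<theta>\<close> and the phases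
  \<open>\<alpha>\<close> of \<open>w\<close>, both measured in full turns. A chord is at most as
  long as its arc, hence the tolerance \<open>\<epsilon> / (2 * pi)\<close>.\<close>

lemma prime_flow_dense:
  assumes "finite S" "\<And>p. p \<in> S \<Longrightarrow> prime p" "\<And>p. p \<in> S \<Longrightarrow> cmod (w p) = 1" "\<epsilon> > 0"
  obtains t where "\<And>p. p \<in> S \<Longrightarrow> cmod (prime_flow t p - w p) \<le> \<epsilon>"
proof -
  obtain h where h: "bij_betw h {..<card S} S"
    using ex_bij_betw_nat_finite[OF \<open>finite S\<close>] by (auto simp: atLeast0LessThan)
  define \<theta> where "\<theta> = (\<lambda>i. - ln (real (h i)) / (2 * pi))"
  define \<alpha> where "\<alpha> = (\<lambda>i. Arg (w (h i)) / (2 * pi))"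
  have hS: "h i \<in> S" if "i < card S" for i using h that by (auto simp: bij_betw_def)
  have inj: "inj_on \<theta> {..<card S}"
  proof (rule inj_onI)
    fix i j assume ij: "i \<in> {..<card S}" "j \<in> {..<card S}" "\<theta> i = \<theta> j"
    then have "h i > 0" "h j > 0" using hS assms(2) prime_gt_0_nat by auto
    then have "h i = h j" using ij by (simp add: \<theta>_def)
    then show "i = j" using h ij by (auto simp: bij_betw_def inj_on_def)
  qed
  \<comment> \<open>Kronecker's theorem asks for independence over the integers, so
    \<open>independent\<close> has to refer to the reals as an integer module.\<close>
  interpret Modules.module "(\<lambda>r. (*) (real_of_int r))"
    by (simp add: Modules.module.intro distrib_left mult.commute)
  have indep: "independent (\<theta> ` {..<card S})"
    unfolding dependent_finite[OF finite_imageI[OF finite_lessThan]]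
  proof safe
    fix u i
    assume i: "i < card S" and "u (\<theta> i) \<noteq> 0"
      and 0: "(\<Sum>v\<in>\<theta> ` {..<card S}. real_of_int (u v) * v) = 0"
    define g where "g = inv_into {..<card S} h"
    have gh: "g (h j) = j" if "j < card S" for j
      using h that by (auto simp: g_def bij_betw_def inv_into_f_f)
    have "(\<Sum>p\<in>S. of_int (u (\<theta> (g p))) * ln (real p)) = (\<Sum>j<card S. of_int (u (\<theta> j)) * ln (real (h j)))"
      by (subst sum.reindex_bij_betw[OF h, symmetric]) (simp add: gh)
    also have "\<dots> = (\<Sum>j<card S. - (2 * pi) * (real_of_int (u (\<theta> j)) * \<theta> j))"
      by (simp add: \<theta>_def)
    also have "\<dots> = 0"
      using 0 unfolding sum_distrib_left[symmetric] by (simp add: sum.reindex[OF inj])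
    finally have "u (\<theta> (g (h i))) = 0"
      by (rule ln_primes_int_independent[OF assms(1,2), of _ "h i", rotated -2])
         (use hS i in auto)
    with \<open>u (\<theta> i) \<noteq> 0\<close> show False using gh i by simp
  qed
  from Kronecker_thm_1[OF indep inj, of "\<epsilon> / (2 * pi)" \<alpha>] \<open>\<epsilon> > 0\<close>
  obtain t k where tk: "\<And>i. i < card S \<Longrightarrow> \<bar>t * \<theta> i - of_int (k i) - \<alpha> i\<bar> < \<epsilon> / (2 * pi)"
    by auto
  show ?thesis
  proof (rule that)
    fix p assume "p \<in> S"
    then obtain i where i: "i < card S" "p = h i" using h by (auto simp: bij_betw_def)
    have w: "w p = exp (\<i> * of_real (2 * pi * \<alpha> i + 2 * pi * of_int (k i)))"
    proof -
      have "w p = exp (\<i> * Arg (w p))"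
        using Arg_eq[of "w p"] assms(3)[OF \<open>p \<in> S\<close>] by force
      also have "\<dots> = exp (\<i> * of_real (2 * pi * \<alpha> i) + 2 * of_int (k i) * of_real pi * \<i>)"
        using exp_integer_2pi[of "of_int (k i)"] by (simp add: exp_add \<alpha>_def i)
      finally show ?thesis by (simp add: algebra_simps)
    qed
    have "cmod (prime_flow t p - w p) \<le> \<bar>- t * ln (real p) - (2 * pi * \<alpha> i + 2 * pi * of_int (k i))\<bar>"
      unfolding prime_flow_def w by (rule cmod_exp_ii_diff_le)
    also have "- t * ln (real p) - (2 * pi * \<alpha> i + 2 * pi * of_int (k i))
        = 2 * pi * (t * \<theta> i - of_int (k i) - \<alpha> i)"
      by (simp add: \<theta>_def i algebra_simps)
    also have "\<bar>\<dots>\<bar> = 2 * pi * \<bar>t * \<theta> i - of_int (k i) - \<alpha> i\<bar>"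
      by (simp only: abs_mult) simp
    also have "\<dots> \<le> \<epsilon>"
      using tk[OF i(1)] by (simp add: pos_less_divide_eq mult.commute)
    finally show "cmod (prime_flow t p - w p) \<le> \<epsilon>" .
  qed
qed

lemma tendsto_prod_mset:
  fixes f :: "nat \<Rightarrow> 'c \<Rightarrow> complex"
  assumes "\<And>p. p \<in># M \<Longrightarrow> (\<lambda>i. f i p) \<longlonglongrightarrow> w p"
  shows "(\<lambda>i. \<Prod>p\<in>#M. f i p) \<longlonglongrightarrow> (\<Prod>p\<in>#M. w p)"
  using assms by (induction M) (auto intro!: tendsto_mult)

text \<open>Density supplies points of the flow that converge to \<open>w\<close> in the finitely
  many coordinates that occur, and the sum is continuous in these.\<close>

lemma monomial_sum_torus_le:
  assumes "finite S" "\<And>p. p \<in> S \<Longrightarrow> prime p"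
    and vars: "\<And>n. n \<in> A \<Longrightarrow> set_mset (F n) \<subseteq> S"
    and line: "\<And>t. cmod (monomial_sum a F A (prime_flow t)) \<le> B"
    and w: "\<And>p. p \<in> S \<Longrightarrow> cmod (w p) = 1"
  shows "cmod (monomial_sum a F A w) \<le> B"
proof -
  have "\<exists>t. \<forall>p\<in>S. cmod (prime_flow t p - w p) \<le> 1 / real (Suc i)" for i
    by (rule prime_flow_dense[where S = S and w = w and \<epsilon> = "1 / real (Suc i)"])
       (use assms(1,2) w in auto)
  then obtain t where t: "\<And>i p. p \<in> S \<Longrightarrow> cmod (prime_flow (t i) p - w p) \<le> 1 / real (Suc i)"
    by metis
  have lim: "(\<lambda>i. prime_flow (t i) p) \<longlonglongrightarrow> w p" if "p \<in> S" for p
  proof (rule LIM_zero_cancel, rule Lim_null_comparison)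
    show "(\<lambda>i. 1 / real (Suc i)) \<longlonglongrightarrow> 0" by (rule LIMSEQ_Suc[OF lim_1_over_n])
    show "\<forall>\<^sub>F i in sequentially. norm (prime_flow (t i) p - w p) \<le> 1 / real (Suc i)"
      using t[OF that] by simp
  qed
  have "(\<lambda>i. monomial_sum a F A (prime_flow (t i))) \<longlonglongrightarrow> monomial_sum a F A w"
    unfolding monomial_sum_def
    by (intro tendsto_sum tendsto_mult tendsto_const tendsto_prod_mset lim) (use vars in blast)
  then show ?thesis
    by (rule Lim_bounded[OF tendsto_norm, where M = 0]) (use line in auto)
qed

section \<open>Dirichlet monomials along the prime flow\<close>

lemma exp_prime_flow_prod_mset:
  assumes "\<And>p. p \<in># M \<Longrightarrow> p > 0"
  shows "exp (\<i> * of_real (- t * ln (real (prod_mset M)))) = (\<Prod>p\<in>#M. prime_flow t p)"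
  using assms
proof (induction M)
  case (add p M)
  have "prod_mset M \<noteq> 0" "p \<noteq> 0" using add.prems by (auto simp: prod_mset_zero_iff)
  then have "ln (real (prod_mset (add_mset p M))) = ln (real p) + ln (real (prod_mset M))"
    by (simp add: ln_mult)
  then have "exp (\<i> * of_real (- t * ln (real (prod_mset (add_mset p M)))))
      = prime_flow t p * exp (\<i> * of_real (- t * ln (real (prod_mset M))))"
    by (simp add: prime_flow_def algebra_simps flip: exp_add)
  then show ?case using add by simp
qed simp

text \<open>The Bohr correspondence. It breaks at \<open>n = 0\<close>, where \<open>powr\<close>
  gives 0 and the empty factorization gives 1.\<close>

lemma of_nat_powr_imaginary:
  assumes "n > 0"
  shows "of_nat n powr (- (\<i> * of_real t)) = (\<Prod>p\<in>#prime_factorization n. prime_flow t p)"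
proof -
  have "of_nat n powr (- (\<i> * of_real t)) = exp (\<i> * of_real (- t * ln (real n)))"
    using assms by (simp add: powr_def Ln_of_nat algebra_simps)
  also have "\<dots> = exp (\<i> * of_real (- t * ln (real (prod_mset (prime_factorization n)))))"
    using assms by (simp add: prod_mset_prime_factorization_nat)
  also have "\<dots> = (\<Prod>p\<in>#prime_factorization n. prime_flow t p)"
    by (rule exp_prime_flow_prod_mset) (auto simp: in_prime_factors_iff prime_gt_0_nat)
  finally show ?thesis .
qed

lemma cmod_prime_flow [simp]: "cmod (prime_flow t p) = 1"
  by (simp add: prime_flow_def)

lemma prime_flow_frac: "prime_flow t p = exp (\<i> * of_real (2 * pi * frac (- t * ln (real p) / (2 * pi))))"
proof -
  define x where "x = - t * ln (real p) / (2 * pi)"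
  have "- t * ln (real p) = 2 * pi * frac x + 2 * pi * of_int \<lfloor>x\<rfloor>"
    by (simp add: frac_def x_def algebra_simps)
  then have "prime_flow t p = exp (\<i> * of_real (2 * pi * frac x) + 2 * of_int \<lfloor>x\<rfloor> * of_real pi * \<i>)"
    unfolding prime_flow_def by (simp add: algebra_simps)
  also have "\<dots> = exp (\<i> * of_real (2 * pi * frac x))"
    using exp_integer_2pi[of "of_int \<lfloor>x\<rfloor>"] by (simp add: exp_add)
  finally show ?thesis by (simp add: x_def)
qed

section \<open>Finitely many test points on the imaginary axis\<close>

lemma dirichlet_polys_bounded:
  assumes "D \<in> dirichlet_polys A"
  obtains B where "\<And>t::real. cmod (D (\<i> * of_real t)) \<le> B"
proof -
  obtain a where D: "D = (\<lambda>s. \<Sum>n\<in>A. a n * of_nat n powr (- s))"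
    using assms by (auto simp: dirichlet_polys_def)
  have "cmod (D (\<i> * of_real t)) \<le> (\<Sum>n\<in>A. cmod (a n))" for t :: real
    unfolding D
  proof (rule order_trans[OF norm_sum sum_mono])
    fix n
    have "cmod (of_nat n powr (- (\<i> * of_real t))) \<le> 1"
      by (cases "n = 0") (auto simp: powr_def Ln_of_nat)
    then show "cmod (a n * of_nat n powr (- (\<i> * of_real t))) \<le> cmod (a n)"
      by (simp add: norm_mult mult_left_le)
  qed
  then show ?thesis by (rule that)
qed

text \<open>For each outcome the random sum is such a combination, so a net made for
  \<open>A\<close> alone serves all outcomes at once.\<close>

lemma sum_in_dirichlet_polys:
  assumes "\<And>j. j < K \<Longrightarrow> D j \<in> dirichlet_polys A"
  shows "(\<lambda>s. \<Sum>j<K. c j * D j s) \<in> dirichlet_polys A"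
proof -
  have "\<forall>j\<in>{..<K}. \<exists>a. D j = (\<lambda>s. \<Sum>n\<in>A. a n * of_nat n powr (- s))"
    using assms by (auto simp: dirichlet_polys_def)
  then obtain a where a: "\<forall>j\<in>{..<K}. D j = (\<lambda>s. \<Sum>n\<in>A. a j n * of_nat n powr (- s))"
    by metis
  have "(\<Sum>j<K. c j * D j s) = (\<Sum>n\<in>A. (\<Sum>j<K. c j * a j n) * of_nat n powr (- s))" for s
  proof -
    have "(\<Sum>j<K. c j * D j s) = (\<Sum>j<K. \<Sum>n\<in>A. c j * a j n * of_nat n powr (- s))"
      using a by (intro sum.cong) (auto simp: sum_distrib_left mult.assoc)
    also have "\<dots> = (\<Sum>n\<in>A. \<Sum>j<K. c j * a j n * of_nat n powr (- s))"
      by (rule sum.swap)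
    finally show ?thesis by (simp add: sum_distrib_right)
  qed
  then show ?thesis by (auto simp: dirichlet_polys_def)
qed

lemma card_primes_le_prime_counting_set:
  assumes "finite A"
  shows "card (\<Union>n\<in>A. {p. prime p \<and> p \<le> n}) \<le> prime_counting_set A"
proof (cases "A = {}")
  case False
  then have "(\<Union>n\<in>A. {p. prime p \<and> p \<le> n}) = {p. prime p \<and> p \<le> Max A}"
    using assms by (auto intro: order_trans[OF _ Max_ge] Max_in)
  then have "card (\<Union>n\<in>A. {p. prime p \<and> p \<le> n}) = prime_counting (Max A)"
    by (simp add: prime_counting_def)
  also have "\<dots> \<le> prime_counting_set A"
    unfolding prime_counting_set_def
    using assms False by (intro cSUP_upper) (auto intro: bdd_above_finite)
  finally show ?thesis .
qed simp

text \<open>With \<open>B\<close> the supremum on the axis, each point has a partner in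
  \<open>T\<close> where the value differs by at most \<open>B / 2\<close>, so
  \<open>B \<le> c + B / 2\<close>. Since \<open>B\<close> is finite, \<open>B \<le> 2 * c\<close>
  follows.\<close>

lemma dirichlet_polys_net:
  assumes "finite A" "0 \<notin> A"
  obtains T :: "real set" where "finite T" "T \<noteq> {}"
    "card T \<le> (80 * max 1 (big_omega_set A)) ^ prime_counting_set A"
    "\<And>D c t. D \<in> dirichlet_polys A \<Longrightarrow> (\<And>t. t \<in> T \<Longrightarrow> cmod (D (\<i> * of_real t)) \<le> c) \<Longrightarrow>
       cmod (D (\<i> * of_real t)) \<le> 2 * c"
proof -
  define S where "S = (\<Union>n\<in>A. {p. prime p \<and> p \<le> n})"
  \<comment> \<open>The maximum with 1 covers the case \<open>big_omega_set A = 0\<close> of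
    constants, where the radii \<open>1 / m\<close> would degenerate.\<close>
  define m where "m = max 1 (big_omega_set A)"
  have "finite {p. prime p \<and> p \<le> n}" for n :: nat
    by (rule finite_subset[of _ "{..n}"]) auto
  then have S: "finite S" "\<And>p. p \<in> S \<Longrightarrow> prime p" using assms(1) by (auto simp: S_def)
  have m: "m \<ge> 1" by (simp add: m_def)
  have deg: "size (prime_factorization n) \<le> m" if "n \<in> A" for n
  proof -
    have "big_omega n \<le> big_omega_set A"
      unfolding big_omega_set_def using assms(1) that by (intro cSUP_upper) (auto intro: bdd_above_finite)
    then show ?thesis by (simp add: big_omega_def m_def)
  qed
  have vars: "set_mset (prime_factorization n) \<subseteq> S" if "n \<in> A" for n
  proof
    fix p assume "p \<in># prime_factorization n"
    then have "prime p" "p dvd n" "n \<noteq> 0" using that assms by (auto simp: in_prime_factors_iff)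
    then show "p \<in> S" using that by (auto simp: S_def intro!: dvd_imp_le)
  qed
  obtain T where T: "finite T" "card T \<le> (80 * m) ^ card S"
    and close: "\<And>t. \<exists>t'\<in>T. \<forall>p\<in>S.
      \<bar>frac (- t * ln (real p) / (2 * pi)) - frac (- t' * ln (real p) / (2 * pi))\<bar> \<le> 1 / real (80 * m)"
    using exists_frac_net[OF S(1), of "80 * m" "\<lambda>t p. - t * ln (real p) / (2 * pi)"] m by auto
  show ?thesis
  proof
    show "finite T" by fact
    show "T \<noteq> {}" using close by blast
    show "card T \<le> (80 * max 1 (big_omega_set A)) ^ prime_counting_set A"
      using T(2) power_increasing[OF card_primes_le_prime_counting_set[OF assms(1)], of "80 * m"] m
      by (simp add: S_def m_def)
    fix D c t
    assume "D \<in> dirichlet_polys A" and c: "\<And>t. t \<in> T \<Longrightarrow> cmod (D (\<i> * of_real t)) \<le> c"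
    then obtain a where D: "D = (\<lambda>s. \<Sum>n\<in>A. a n * of_nat n powr (- s))"
      by (auto simp: dirichlet_polys_def)
    have D_eq: "D (\<i> * of_real t) = monomial_sum a prime_factorization A (prime_flow t)" for t
      unfolding D monomial_sum_def using assms(2)
      by (intro sum.cong refl arg_cong2[where f = times] of_nat_powr_imaginary) (auto intro!: gr0I)
    define B where "B = (SUP t::real. cmod (D (\<i> * of_real t)))"
    have bdd: "bdd_above (range (\<lambda>t::real. cmod (D (\<i> * of_real t))))"
      using dirichlet_polys_bounded[OF \<open>D \<in> _\<close>] by (metis bdd_aboveI2)
    have B: "cmod (D (\<i> * of_real t)) \<le> B" for t :: real
      unfolding B_def using bdd by (intro cSUP_upper) auto
    have "cmod (D (\<i> * of_real t)) \<le> c + B / 2" for t :: real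
    proof -
      obtain t' where t': "t' \<in> T" and tt': "\<And>p. p \<in> S \<Longrightarrow>
          \<bar>frac (- t * ln (real p) / (2 * pi)) - frac (- t' * ln (real p) / (2 * pi))\<bar> \<le> 1 / real (80 * m)"
        using close[of t] by blast
      have flow: "cmod (prime_flow t p - prime_flow t' p) \<le> 1 / (12 * m)" if "p \<in> S" for p
      proof -
        define d where "d = frac (- t * ln (real p) / (2 * pi)) - frac (- t' * ln (real p) / (2 * pi))"
        have "cmod (prime_flow t p - prime_flow t' p) \<le> \<bar>2 * pi * d\<bar>"
          unfolding prime_flow_frac d_def right_diff_distrib by (rule cmod_exp_ii_diff_le)
        also have "\<dots> = 2 * pi * \<bar>d\<bar>" by (simp only: abs_mult) simp
        \<comment> \<open>Origin of 80: a cell of width \<open>1 / (80 * m)\<close> is an arc of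
          length below \<open>1 / (12 * m)\<close>, as
          \<open>6.4 / 80 = 0.08 < 1 / 12\<close>.\<close>
        also have "\<dots> \<le> 2 * 3.2 * (1 / real (80 * m))"
          using tt'[OF that] pi_approx by (intro mult_mono) (auto simp: d_def)
        also have "\<dots> \<le> 1 / (12 * m)" using m by (simp add: field_simps)
        finally show ?thesis .
      qed
      have "cmod (D (\<i> * of_real t) - D (\<i> * of_real t')) \<le> B / 2"
        unfolding D_eq
      proof (rule monomial_sum_close[OF S(1) deg m])
        show "cmod (monomial_sum a prime_factorization A z) \<le> B" if "\<And>p. p \<in> S \<Longrightarrow> cmod (z p) = 1" for z
          by (rule monomial_sum_torus_le[OF S vars _ that]) (simp_all add: B flip: D_eq)
      qed (use flow in auto)
      then show ?thesis
        using c[OF t'] norm_triangle_sub[of "D (\<i> * of_real t)" "D (\<i> * of_real t')"] by linarith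
    qed
    then have "B \<le> c + B / 2" unfolding B_def by (intro cSUP_least) auto
    then show "cmod (D (\<i> * of_real t)) \<le> 2 * c" using B[of t] by linarith
  qed
qed

subsection \<open>Subgaussian random variables\<close>

lemma complex_subgaussian_bound_mono:
  assumes "complex_subgaussian_bound P s f" "s \<le> s'"
  shows "complex_subgaussian_bound P s' f"
proof -
  have "s\<^sup>2 \<le> s'\<^sup>2" using assms by (auto simp: complex_subgaussian_bound_def intro: power_mono)
  then have "ennreal (exp (s\<^sup>2 * (cmod z)\<^sup>2 / 2)) \<le> ennreal (exp (s'\<^sup>2 * (cmod z)\<^sup>2 / 2))" for z
    by (intro ennreal_leI) (simp add: mult_right_mono)
  then show ?thesis using assms unfolding complex_subgaussian_bound_def by (meson order_trans)
qed

lemma complex_subgaussian_bound_of_real: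
  assumes "real_subgaussian_bound P s g"
  shows "complex_subgaussian_bound P s (\<lambda>\<omega>. of_real (g \<omega>))"
proof -
  have "(\<integral>\<^sup>+ \<omega>. ennreal (exp (Re (z * of_real (g \<omega>)))) \<partial>P) \<le> ennreal (exp (s\<^sup>2 * (cmod z)\<^sup>2 / 2))" for z
  proof -
    have "(\<integral>\<^sup>+ \<omega>. ennreal (exp (Re (z * of_real (g \<omega>)))) \<partial>P) \<le> ennreal (exp (s\<^sup>2 * (Re z)\<^sup>2 / 2))"
      using assms by (auto simp: real_subgaussian_bound_def)
    also have "(Re z)\<^sup>2 \<le> (cmod z)\<^sup>2" by (simp add: cmod_power2)
    then have "ennreal (exp (s\<^sup>2 * (Re z)\<^sup>2 / 2)) \<le> ennreal (exp (s\<^sup>2 * (cmod z)\<^sup>2 / 2))"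
      by (intro ennreal_leI) (simp add: mult_left_mono)
    finally show ?thesis .
  qed
  then show ?thesis using assms by (simp add: complex_subgaussian_bound_def real_subgaussian_bound_def)
qed

text \<open>Attainment of the infimum is avoided by taking an admissible constant less than 1 above
  the supremum; the final constants may depend on \<open>s\<close> and absorb this loss.\<close>

lemma Inf_family_lessD:
  fixes Q :: "'b \<Rightarrow> real \<Rightarrow> bool"
  assumes "\<exists>x. Q j x" and "bdd_above (range (\<lambda>j. Inf {x. Q j x}))"
  obtains x where "Q j x" "x < (SUP j. Inf {x. Q j x}) + 1"
proof -
  have "Inf {x. Q j x} \<le> (SUP j. Inf {x. Q j x})"
    using assms(2) by (intro cSUP_upper) auto
  then have "\<exists>x\<in>{x. Q j x}. x < (SUP j. Inf {x. Q j x}) + 1"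
    by (intro cInf_lessD) (use assms(1) in auto)
  then show ?thesis using that by auto
qed

lemma subgaussian_sequence_bound:
  assumes "subgaussian_sequence P \<gamma> s"
  shows "complex_subgaussian_bound P (s + 1) (\<gamma> j)"
  using assms unfolding subgaussian_sequence_def
proof (elim disjE exE conjE)
  fix g
  assume \<gamma>: "\<forall>j \<omega>. \<gamma> j \<omega> = complex_of_real (g j \<omega>)" and sub: "\<forall>j. real_subgaussian P (g j)"
    and bdd: "bdd_above (range (\<lambda>j. real_sg P (g j)))" and s: "s = (SUP j. real_sg P (g j))"
  have "\<exists>x. real_subgaussian_bound P x (g j)" using sub by (simp add: real_subgaussian_def)
  then obtain s' where s': "real_subgaussian_bound P s' (g j)" "s' < s + 1"
    unfolding s real_sg_def by (rule Inf_family_lessD[OF _ bdd[unfolded real_sg_def]])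
  have "\<gamma> j = (\<lambda>\<omega>. of_real (g j \<omega>))" using \<gamma> by auto
  then show ?thesis
    using complex_subgaussian_bound_mono[OF complex_subgaussian_bound_of_real[OF s'(1)]] s'(2) by simp
next
  assume sub: "\<forall>j. complex_subgaussian P (\<gamma> j)"
    and bdd: "bdd_above (range (\<lambda>j. complex_sg P (\<gamma> j)))" and s: "s = (SUP j. complex_sg P (\<gamma> j))"
  have "\<exists>x. complex_subgaussian_bound P x (\<gamma> j)" using sub by (simp add: complex_subgaussian_def)
  then obtain s' where s': "complex_subgaussian_bound P s' (\<gamma> j)" "s' < s + 1"
    unfolding s complex_sg_def by (rule Inf_family_lessD[OF _ bdd[unfolded complex_sg_def]])
  then show ?thesis by (intro complex_subgaussian_bound_mono[OF s'(1)]) simp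
qed

context prob_space
begin

text \<open>The exponential moment of an independent sum factorizes, which makes the constants add
  in squares. Apart from measurability, independence enters only here.\<close>

lemma complex_subgaussian_bound_sum:
  assumes indep: "indep_vars (\<lambda>_. borel) \<gamma> (UNIV :: nat set)"
    and sub: "\<And>j. complex_subgaussian_bound M s (\<gamma> j)"
  shows "complex_subgaussian_bound M (s * sqrt (\<Sum>j<K. (cmod (c j))\<^sup>2)) (\<lambda>\<omega>. \<Sum>j<K. \<gamma> j \<omega> * c j)"
proof -
  have sub': "(\<integral>\<^sup>+ \<omega>. ennreal (exp (Re (z * \<gamma> j \<omega>))) \<partial>M) \<le> ennreal (exp (s\<^sup>2 * (cmod z)\<^sup>2 / 2))" for z j
    using sub unfolding complex_subgaussian_bound_def by blast
  have "(\<integral>\<^sup>+ \<omega>. ennreal (exp (Re (z * (\<Sum>j<K. \<gamma> j \<omega> * c j)))) \<partial>M)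
      \<le> ennreal (exp ((s * sqrt (\<Sum>j<K. (cmod (c j))\<^sup>2))\<^sup>2 * (cmod z)\<^sup>2 / 2))" for z
  proof -
    have "exp (Re (z * (\<Sum>j<K. \<gamma> j \<omega> * c j))) = (\<Prod>j<K. exp (Re (z * c j * \<gamma> j \<omega>)))" for \<omega>
      by (simp add: sum_distrib_left mult_ac flip: exp_sum)
    then have "(\<integral>\<^sup>+ \<omega>. ennreal (exp (Re (z * (\<Sum>j<K. \<gamma> j \<omega> * c j)))) \<partial>M)
        = (\<integral>\<^sup>+ \<omega>. (\<Prod>j<K. ennreal (exp (Re (z * c j * \<gamma> j \<omega>)))) \<partial>M)"
      by (simp add: prod_ennreal)
    also have "\<dots> = (\<Prod>j<K. \<integral>\<^sup>+ \<omega>. ennreal (exp (Re (z * c j * \<gamma> j \<omega>))) \<partial>M)"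
      by (rule indep_vars_nn_integral)
         (auto intro!: indep_vars_compose2[OF indep_vars_subset[OF indep]])
    also have "\<dots> \<le> (\<Prod>j<K. ennreal (exp (s\<^sup>2 * (cmod (z * c j))\<^sup>2 / 2)))"
      by (intro prod_mono_ennreal sub')
    also have "\<dots> = ennreal (exp (\<Sum>j<K. s\<^sup>2 * (cmod (z * c j))\<^sup>2 / 2))"
      by (simp add: prod_ennreal exp_sum)
    also have "(\<Sum>j<K. s\<^sup>2 * (cmod (z * c j))\<^sup>2 / 2)
        = (s * sqrt (\<Sum>j<K. (cmod (c j))\<^sup>2))\<^sup>2 * (cmod z)\<^sup>2 / 2"
    proof -
      have "(s * sqrt (\<Sum>j<K. (cmod (c j))\<^sup>2))\<^sup>2 * (cmod z)\<^sup>2 / 2 = s\<^sup>2 * (cmod z)\<^sup>2 / 2 * (\<Sum>j<K. (cmod (c j))\<^sup>2)"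
        by (simp add: power_mult_distrib sum_nonneg)
      also have "\<dots> = (\<Sum>j<K. s\<^sup>2 * (cmod (z * c j))\<^sup>2 / 2)"
        unfolding sum_distrib_left by (simp add: norm_mult power_mult_distrib mult.assoc)
      finally show ?thesis by simp
    qed
    finally show ?thesis .
  qed
  moreover have "0 \<le> s" using sub by (auto simp: complex_subgaussian_bound_def)
  ultimately show ?thesis by (simp add: complex_subgaussian_bound_def sum_nonneg)
qed

lemma complex_subgaussian_bound_half_plane:
  assumes [measurable]: "Y \<in> borel_measurable M" and sub: "complex_subgaussian_bound M \<sigma> Y"
    and "\<sigma> > 0" "v \<ge> 0" "cmod z = 1"
  shows "emeasure M {\<omega>\<in>space M. Re (z * Y \<omega>) \<ge> v} \<le> ennreal (exp (- v\<^sup>2 / (2 * \<sigma>\<^sup>2)))"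
proof -
  \<comment> \<open>Chernoff's method: this \<open>l\<close> minimizes the exponent
    \<open>- l * v + \<sigma>\<^sup>2 * l\<^sup>2 / 2\<close>.\<close>
  define l where "l = v / \<sigma>\<^sup>2"
  have "l \<ge> 0" using assms by (simp add: l_def)
  have "emeasure M {\<omega>\<in>space M. Re (z * Y \<omega>) \<ge> v}
      = (\<integral>\<^sup>+ \<omega>. indicator {\<omega>\<in>space M. Re (z * Y \<omega>) \<ge> v} \<omega> \<partial>M)"
    by simp
  also have "\<dots> \<le> (\<integral>\<^sup>+ \<omega>. ennreal (exp (- l * v)) * ennreal (exp (Re (of_real l * z * Y \<omega>))) \<partial>M)"
  proof (rule nn_integral_mono)
    fix \<omega>
    have "1 \<le> exp (- l * v) * exp (Re (of_real l * z * Y \<omega>))" if "Re (z * Y \<omega>) \<ge> v"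
      using mult_left_mono[OF that \<open>l \<ge> 0\<close>] by (simp add: mult.assoc flip: exp_add)
    then show "indicator {\<omega>\<in>space M. Re (z * Y \<omega>) \<ge> v} \<omega>
        \<le> ennreal (exp (- l * v)) * ennreal (exp (Re (of_real l * z * Y \<omega>)))"
      by (auto simp: indicator_def simp flip: ennreal_mult'')
  qed
  also have "\<dots> = ennreal (exp (- l * v)) * (\<integral>\<^sup>+ \<omega>. ennreal (exp (Re (of_real l * z * Y \<omega>))) \<partial>M)"
    by (intro nn_integral_cmult) measurable
  also have "\<dots> \<le> ennreal (exp (- l * v)) * ennreal (exp (\<sigma>\<^sup>2 * (cmod (of_real l * z))\<^sup>2 / 2))"
    using sub unfolding complex_subgaussian_bound_def by (intro mult_left_mono) (blast, simp)
  also have "\<dots> = ennreal (exp (- l * v + \<sigma>\<^sup>2 * l\<^sup>2 / 2))"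
    unfolding exp_add using assms(5) by (simp add: norm_mult ennreal_mult'')
  also have "- l * v + \<sigma>\<^sup>2 * l\<^sup>2 / 2 = - v\<^sup>2 / (2 * \<sigma>\<^sup>2)"
    using \<open>\<sigma> > 0\<close> by (simp add: l_def field_simps power2_eq_square)
  finally show ?thesis .
qed

text \<open>A modulus of at least \<open>u\<close> forces one of \<open>Re Y\<close>,
  \<open>- Re Y\<close>, \<open>Im Y\<close>, \<open>- Im Y\<close> to reach
  \<open>u / sqrt 2\<close>. The four half planes give the factor 4, and
  \<open>v\<^sup>2 = u\<^sup>2 / 2\<close> turns \<open>2 * \<sigma>\<^sup>2\<close> into
  \<open>4 * \<sigma>\<^sup>2\<close>.\<close>

lemma complex_subgaussian_bound_tail:
  assumes [measurable]: "Y \<in> borel_measurable M" and sub: "complex_subgaussian_bound M \<sigma> Y"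
    and "\<sigma> > 0" "u \<ge> 0"
  shows "emeasure M {\<omega>\<in>space M. cmod (Y \<omega>) \<ge> u} \<le> ennreal (4 * exp (- u\<^sup>2 / (4 * \<sigma>\<^sup>2)))"
proof -
  define v where "v = u / sqrt 2"
  have v: "v \<ge> 0" "v\<^sup>2 = u\<^sup>2 / 2" using assms by (auto simp: v_def power_divide)
  define H where "H = (\<lambda>z. {\<omega>\<in>space M. Re (z * Y \<omega>) \<ge> v})"
  have [measurable]: "H z \<in> sets M" for z unfolding H_def by measurable
  have "{\<omega>\<in>space M. cmod (Y \<omega>) \<ge> u} \<subseteq> (\<Union>z\<in>{1, -1, \<i>, -\<i>}. H z)"
  proof (rule subsetI, rule ccontr)
    fix \<omega> assume \<omega>: "\<omega> \<in> {\<omega>\<in>space M. cmod (Y \<omega>) \<ge> u}" "\<omega> \<notin> (\<Union>z\<in>{1, -1, \<i>, -\<i>}. H z)"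
    then have "\<bar>Re (Y \<omega>)\<bar> < v" "\<bar>Im (Y \<omega>)\<bar> < v" by (auto simp: H_def)
    then have "(Re (Y \<omega>))\<^sup>2 < v\<^sup>2" "(Im (Y \<omega>))\<^sup>2 < v\<^sup>2"
      by (metis abs_ge_zero power2_abs power_strict_mono zero_less_numeral)+
    then have "(cmod (Y \<omega>))\<^sup>2 < u\<^sup>2" using v by (simp add: cmod_power2)
    then have "cmod (Y \<omega>) < u" using \<open>u \<ge> 0\<close> by (rule power_less_imp_less_base)
    then show False using \<omega>(1) by simp
  qed
  then have "emeasure M {\<omega>\<in>space M. cmod (Y \<omega>) \<ge> u} \<le> emeasure M (\<Union>z\<in>{1, -1, \<i>, -\<i>}. H z)"
    by (intro emeasure_mono) auto
  also have "\<dots> \<le> (\<Sum>z\<in>{1, -1, \<i>, -\<i>}. emeasure M (H z))"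
    by (intro emeasure_subadditive_finite) auto
  also have "\<dots> \<le> (\<Sum>z\<in>{1, -1, \<i>, -\<i>}. ennreal (exp (- v\<^sup>2 / (2 * \<sigma>\<^sup>2))))"
    unfolding H_def using assms v
    by (intro sum_mono complex_subgaussian_bound_half_plane) auto
  also have "\<dots> = of_nat (card {1, -1, \<i>, -\<i>}) * ennreal (exp (- v\<^sup>2 / (2 * \<sigma>\<^sup>2)))"
    by (rule sum_constant)
  also have "\<dots> \<le> of_nat 4 * ennreal (exp (- v\<^sup>2 / (2 * \<sigma>\<^sup>2)))"
    using card_length[of "[1, -1, \<i>, -\<i>]"] by (intro mult_right_mono of_nat_mono) auto
  also have "\<dots> = ennreal (4 * exp (- u\<^sup>2 / (4 * \<sigma>\<^sup>2)))"
    by (simp add: v ennreal_mult'')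
  finally show ?thesis .
qed

text \<open>Where the exponent has integer part \<open>k\<close>, the integrand is at most
  \<open>exp (k + 1)\<close>, and by the tail this has probability at most
  \<open>4 * exp (- 2 * k)\<close>. The geometric series sums to \<open>4 * e * e / (e - 1)\<close>
  with \<open>e = exp 1\<close>, which is below 18.\<close>

lemma nn_integral_exp_powr_le_18:
  fixes Y :: "'a \<Rightarrow> real"
  assumes [measurable]: "Y \<in> borel_measurable M" and "r > 0" "c > 0"
    and tail: "\<And>k::nat. k \<ge> 1 \<Longrightarrow>
      emeasure M {\<omega>\<in>space M. \<bar>Y \<omega>\<bar> \<ge> c * real k powr (1 / r)} \<le> ennreal (4 * exp (- 2 * real k))"
  shows "(\<integral>\<^sup>+ \<omega>. ennreal (exp ((\<bar>Y \<omega>\<bar> / c) powr r)) \<partial>M) \<le> 18"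
proof -
  define E where "E = (\<lambda>k::nat. {\<omega>\<in>space M. \<bar>Y \<omega>\<bar> \<ge> c * real k powr (1 / r)})"
  have [measurable]: "E k \<in> sets M" for k unfolding E_def by measurable
  have E_le: "emeasure M (E k) \<le> ennreal (4 * exp (- 2 * real k))" for k
  proof (cases "k = 0")
    case True
    have "emeasure M (E k) \<le> 1" by (rule measure_le_1)
    also have "\<dots> \<le> ennreal (4 * exp (- 2 * real k))" using True by simp
    finally show ?thesis .
  qed (use tail[of k] in \<open>auto simp: E_def\<close>)
  have "(\<integral>\<^sup>+ \<omega>. ennreal (exp ((\<bar>Y \<omega>\<bar> / c) powr r)) \<partial>M)
      \<le> (\<integral>\<^sup>+ \<omega>. (\<Sum>k. ennreal (exp (real k + 1)) * indicator (E k) \<omega>) \<partial>M)"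
  proof (rule nn_integral_mono)
    fix \<omega> assume "\<omega> \<in> space M"
    define x where "x = (\<bar>Y \<omega>\<bar> / c) powr r"
    define k where "k = nat \<lfloor>x\<rfloor>"
    have x: "x \<ge> 0" by (simp add: x_def)
    then have k: "real k \<le> x" "x \<le> real k + 1" unfolding k_def by linarith+
    have "real k powr (1 / r) \<le> x powr (1 / r)" using k \<open>r > 0\<close> by (intro powr_mono2) auto
    also have "\<dots> = \<bar>Y \<omega>\<bar> / c" using assms by (simp add: x_def powr_powr)
    finally have "\<omega> \<in> E k" using \<open>\<omega> \<in> space M\<close> \<open>c > 0\<close> by (simp add: E_def field_simps)
    have "ennreal (exp x) \<le> ennreal (exp (real k + 1)) * indicator (E k) \<omega>"
      using \<open>\<omega> \<in> E k\<close> k by (simp add: ennreal_leI)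
    also have "\<dots> \<le> (\<Sum>k. ennreal (exp (real k + 1)) * indicator (E k) \<omega>)"
    proof -
      have "(\<Sum>k\<in>{k}. ennreal (exp (real k + 1)) * indicator (E k) \<omega>)
          \<le> (\<Sum>k. ennreal (exp (real k + 1)) * indicator (E k) \<omega>)"
        by (rule sum_le_suminf) auto
      then show ?thesis by (simp only: sum.insert[OF finite.emptyI] sum.empty empty_iff not_False_eq_True add_0_right)
    qed
    finally show "ennreal (exp ((\<bar>Y \<omega>\<bar> / c) powr r)) \<le> (\<Sum>k. ennreal (exp (real k + 1)) * indicator (E k) \<omega>)"
      by (simp add: x_def)
  qed
  also have "\<dots> = (\<Sum>k. ennreal (exp (real k + 1)) * emeasure M (E k))"
    by (subst nn_integral_suminf) (auto simp: nn_integral_cmult_indicator)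
  also have "\<dots> \<le> (\<Sum>k. ennreal (4 * exp 1 * exp (- 1) ^ k))"
  proof (rule suminf_le)
    fix k
    have "ennreal (exp (real k + 1)) * emeasure M (E k) \<le> ennreal (exp (real k + 1)) * ennreal (4 * exp (- 2 * real k))"
      by (intro mult_left_mono E_le) simp
    also have "\<dots> = ennreal (4 * (exp (real k + 1) * exp (- 2 * real k)))"
      by (simp add: mult_ac flip: ennreal_mult'')
    also have "exp (real k + 1) * exp (- 2 * real k) = exp (1 + real k * (- 1))"
      by (simp flip: exp_add)
    also have "4 * \<dots> = 4 * exp 1 * exp (- 1) ^ k"
      unfolding exp_add exp_of_nat_mult by simp
    finally show "ennreal (exp (real k + 1)) * emeasure M (E k) \<le> ennreal (4 * exp 1 * exp (- 1) ^ k)" .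
  qed auto
  also have "\<dots> = ennreal (\<Sum>k. 4 * exp 1 * exp (- 1 :: real) ^ k)"
    by (rule suminf_ennreal2) (auto intro!: summable_mult summable_geometric)
  also have "(\<Sum>k. 4 * exp 1 * exp (- 1 :: real) ^ k) = 4 * exp 1 * (1 / (1 - exp (- 1)))"
    by (subst suminf_mult) (auto intro!: summable_geometric simp: suminf_geometric)
  also have "\<dots> \<le> 18"
  proof -
    define e where "e = exp (1::real)"
    have e: "e \<le> 3" "e \<ge> 2" using exp_le exp_ge_add_one_self[of "1::real"] by (auto simp: e_def)
    \<comment> \<open>Expanded and doubled, this is the next inequality; the quadratic has the roots
      3/2 and 3, which enclose \<open>e\<close>.\<close>
    then have "(3 - e) * (2 * e - 3) \<ge> 0" by simp
    then have "4 * e * e \<le> 18 * (e - 1)" by (simp add: algebra_simps)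
    then show ?thesis using e unfolding exp_minus e_def[symmetric] by (simp add: field_simps)
  qed
  finally show ?thesis by (simp add: ennreal_leI)
qed

text \<open>
  With \<open>Z t = exp ((\<bar>Y t\<bar> / c) powr r)\<close>, dividing the exponent by \<open>\<Lambda>\<close> turns the union bound
  \<open>18 * card T \<le> 2 powr \<Lambda>\<close> for the maximum of the \<open>Z t\<close> into the bound \<open>2\<close>, by concavity of
  \<open>\<lambda>x. x powr (1 / \<Lambda>)\<close>.
\<close>

lemma luxemburg_norm_max_le:
  fixes Y :: "'t \<Rightarrow> 'a \<Rightarrow> real"
  assumes "finite T" and [measurable]: "\<And>t. t \<in> T \<Longrightarrow> Y t \<in> borel_measurable M"
    and "r > 0" "c > 0" "\<Lambda> \<ge> 2" "18 * real (card T) \<le> 2 powr \<Lambda>"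
    and int: "\<And>t. t \<in> T \<Longrightarrow> (\<integral>\<^sup>+ \<omega>. ennreal (exp ((\<bar>Y t \<omega>\<bar> / c) powr r)) \<partial>M) \<le> 18"
    and X: "\<And>\<omega>. \<omega> \<in> space M \<Longrightarrow> \<exists>t\<in>T. \<bar>X \<omega>\<bar> \<le> 2 * \<bar>Y t \<omega>\<bar>"
  shows "luxemburg_norm M r X \<le> ennreal (2 * c * \<Lambda> powr (1 / r))"
proof -
  \<comment> \<open>The weight of each \<open>Z t\<close> after Young's inequality. Since
    \<open>18 * card T \<le> 2 powr \<Lambda>\<close>, the weighted integrals add up to at most
    \<open>2 / \<Lambda>\<close>, exactly what \<open>1 - 2 / \<Lambda>\<close> leaves free below
    1.\<close>
  define b where "b = 2 / (\<Lambda> * 2 powr \<Lambda>)"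
  have "b \<ge> 0" using assms by (simp add: b_def)
  define Z where "Z = (\<lambda>t \<omega>. exp ((\<bar>Y t \<omega>\<bar> / c) powr r))"
  define \<epsilon> where "\<epsilon> = 2 * c * \<Lambda> powr (1 / r)"
  have "\<epsilon> > 0" using assms by (simp add: \<epsilon>_def)
  have pointwise: "orlicz_exp r (\<bar>X \<omega>\<bar> / \<epsilon>) \<le> 1 - 2 / \<Lambda> + (\<Sum>t\<in>T. b * Z t \<omega>)" if \<omega>: "\<omega> \<in> space M" for \<omega>
  proof -
    obtain t where t: "t \<in> T" "\<bar>X \<omega>\<bar> \<le> 2 * \<bar>Y t \<omega>\<bar>" using X[OF \<omega>] by blast
    have "(\<bar>X \<omega>\<bar> / \<epsilon>) powr r \<le> (2 * \<bar>Y t \<omega>\<bar> / \<epsilon>) powr r"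
      using t \<open>\<epsilon> > 0\<close> \<open>r > 0\<close> by (intro powr_mono2 divide_right_mono) auto
    also have "2 * \<bar>Y t \<omega>\<bar> / \<epsilon> = (\<bar>Y t \<omega>\<bar> / c) / \<Lambda> powr (1 / r)" by (simp add: \<epsilon>_def)
    also have "\<dots> powr r = (\<bar>Y t \<omega>\<bar> / c) powr r / \<Lambda>"
      using assms by (subst powr_divide) (auto simp: powr_powr)
    finally have "exp ((\<bar>X \<omega>\<bar> / \<epsilon>) powr r) \<le> exp ((\<bar>Y t \<omega>\<bar> / c) powr r / \<Lambda>)" by simp
    also have "\<dots> = Z t \<omega> powr (1 / \<Lambda>)" by (simp add: Z_def powr_def)
    also have "\<dots> = 2 * ((Z t \<omega> / 2 powr \<Lambda>) powr (1 / \<Lambda>) * 1 powr (1 - 1 / \<Lambda>))"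
      using assms by (simp add: powr_divide powr_powr Z_def)
    also have "(Z t \<omega> / 2 powr \<Lambda>) powr (1 / \<Lambda>) * 1 powr (1 - 1 / \<Lambda>)
        \<le> (1 / \<Lambda>) * (Z t \<omega> / 2 powr \<Lambda>) + (1 - 1 / \<Lambda>) * 1"
      using assms by (intro Youngs_inequality_0) (auto simp: Z_def)
    also have "2 * ((1 / \<Lambda>) * (Z t \<omega> / 2 powr \<Lambda>) + (1 - 1 / \<Lambda>) * 1) = b * Z t \<omega> + (2 - 2 / \<Lambda>)"
      using assms by (simp add: b_def field_simps)
    \<comment> \<open>The index \<open>t\<close> varies with \<open>\<omega>\<close>; summing over
      \<open>T\<close> removes it and gives a measurable majorant, so that measurability of
      \<open>X\<close> is never at issue.\<close>
    also have "b * Z t \<omega> \<le> (\<Sum>t\<in>T. b * Z t \<omega>)"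
      using t assms \<open>b \<ge> 0\<close> by (intro member_le_sum) (auto simp: Z_def)
    finally show ?thesis by (simp add: orlicz_exp_def)
  qed
  have [measurable]: "(\<lambda>\<omega>. ennreal (Z t \<omega>)) \<in> borel_measurable M" if "t \<in> T" for t
    using that unfolding Z_def by measurable
  have "(\<integral>\<^sup>+ \<omega>. ennreal (orlicz_exp r (\<bar>X \<omega>\<bar> / \<epsilon>)) \<partial>M)
      \<le> (\<integral>\<^sup>+ \<omega>. ennreal (1 - 2 / \<Lambda>) + (\<Sum>t\<in>T. ennreal b * ennreal (Z t \<omega>)) \<partial>M)"
  proof (rule nn_integral_mono)
    fix \<omega> assume "\<omega> \<in> space M"
    have "ennreal (orlicz_exp r (\<bar>X \<omega>\<bar> / \<epsilon>)) \<le> ennreal (1 - 2 / \<Lambda> + (\<Sum>t\<in>T. b * Z t \<omega>))"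
      by (intro ennreal_leI pointwise) fact
    also have "\<dots> = ennreal (1 - 2 / \<Lambda>) + (\<Sum>t\<in>T. ennreal b * ennreal (Z t \<omega>))"
      using assms \<open>b \<ge> 0\<close>
      by (subst ennreal_plus) (auto simp: Z_def sum_nonneg ennreal_mult simp flip: sum_ennreal)
    finally show "ennreal (orlicz_exp r (\<bar>X \<omega>\<bar> / \<epsilon>)) \<le> ennreal (1 - 2 / \<Lambda>) + (\<Sum>t\<in>T. ennreal b * ennreal (Z t \<omega>))" .
  qed
  also have "\<dots> = ennreal (1 - 2 / \<Lambda>) + (\<Sum>t\<in>T. ennreal b * (\<integral>\<^sup>+ \<omega>. ennreal (Z t \<omega>) \<partial>M))"
    using assms
    by (subst nn_integral_add) (auto simp: nn_integral_sum nn_integral_cmult emeasure_space_1 intro!: borel_measurable_sum)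
  also have "\<dots> \<le> ennreal (1 - 2 / \<Lambda>) + (\<Sum>t\<in>T. ennreal b * ennreal 18)"
    using int by (intro add_left_mono sum_mono mult_left_mono) (auto simp: Z_def)
  also have "\<dots> = ennreal (1 - 2 / \<Lambda> + b * (18 * real (card T)))"
  proof -
    have "(\<Sum>t\<in>T. ennreal b * ennreal 18) = ennreal (\<Sum>t\<in>T. b * 18)"
      using \<open>b \<ge> 0\<close> by (subst sum_ennreal[symmetric]) (auto simp: ennreal_mult'')
    also have "(\<Sum>t\<in>T. b * 18) = b * (18 * real (card T))" by simp
    finally show ?thesis
      using assms(5) \<open>b \<ge> 0\<close> by (subst ennreal_plus) auto
  qed
  also have "\<dots> \<le> ennreal 1"
  proof (rule ennreal_leI)
    have "b * (18 * real (card T)) \<le> b * 2 powr \<Lambda>" using assms \<open>b \<ge> 0\<close> by (intro mult_left_mono)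
    also have "\<dots> = 2 / \<Lambda>" by (simp add: b_def)
    finally show "1 - 2 / \<Lambda> + b * (18 * real (card T)) \<le> 1" by simp
  qed
  finally show ?thesis
    unfolding luxemburg_norm_def using \<open>\<epsilon> > 0\<close> by (intro Inf_lower) (auto simp: \<epsilon>_def)
qed

end

subsection \<open>Rearrangements and exponential moments\<close>

text \<open>The hypothesis says that \<open>\<tau>\<close> dominates the decreasing rearrangement of \<open>a\<close>.\<close>

lemma sum_le_sum_of_card_less:
  fixes a :: "'b \<Rightarrow> real" and \<tau> :: "nat \<Rightarrow> real"
  assumes "finite J" and "mono_on {0..} f" and "\<And>j. j \<in> J \<Longrightarrow> a j \<ge> 0" and "\<And>k. \<tau> k \<ge> 0"
    and "\<And>k. k \<ge> 1 \<Longrightarrow> card {j\<in>J. a j > \<tau> k} < k"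
  shows "(\<Sum>j\<in>J. f (a j)) \<le> (\<Sum>k=1..card J. f (\<tau> k) :: real)"
  using assms(1,3,5)
proof (induction "card J" arbitrary: J)
  case (Suc n)
  then have "J \<noteq> {}" by auto
  then obtain j0 where j0: "j0 \<in> J" "\<And>j. j \<in> J \<Longrightarrow> a j0 \<le> a j"
    using ex_min_if_finite[of "a ` J"] \<open>finite J\<close> by (metis (no_types, lifting) arg_min_if_finite(1) arg_min_least)
  \<comment> \<open>The smallest of the \<open>Suc n\<close> values is paired with the last
    threshold; were it larger, all \<open>Suc n\<close> values would exceed that threshold.\<close>
  have "a j0 \<le> \<tau> (Suc n)"
  proof (rule ccontr)
    assume "\<not> ?thesis"
    then have "{j\<in>J. a j > \<tau> (Suc n)} = J" using j0 by force
    then show False using Suc.prems(3)[of "Suc n"] Suc.hyps(2) by simp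
  qed
  then have le: "f (a j0) \<le> f (\<tau> (Suc n))"
    using assms(2,4) Suc.prems(2)[OF j0(1)] by (auto intro: mono_onD)
  have "(\<Sum>j\<in>J - {j0}. f (a j)) \<le> (\<Sum>k=1..card (J - {j0}). f (\<tau> k))"
  proof (rule Suc.hyps(1))
    show "n = card (J - {j0})" using Suc.hyps(2) j0 \<open>finite J\<close> by simp
    fix k :: nat assume "k \<ge> 1"
    have "card {j\<in>J - {j0}. a j > \<tau> k} \<le> card {j\<in>J. a j > \<tau> k}"
      using \<open>finite J\<close> by (intro card_mono) auto
    then show "card {j\<in>J - {j0}. a j > \<tau> k} < k" using Suc.prems(3)[OF \<open>k \<ge> 1\<close>] by simp
  qed (use Suc.prems in auto)
  moreover have "card (J - {j0}) = n" using Suc.hyps(2) j0 \<open>finite J\<close> by simp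
  moreover have "(\<Sum>j\<in>J. f (a j)) = f (a j0) + (\<Sum>j\<in>J - {j0}. f (a j))"
    using j0 \<open>finite J\<close> by (simp add: sum.remove)
  ultimately show ?case using le by (simp flip: Suc.hyps(2))
qed simp

text \<open>A telescoping form of the comparison with an integral: by concavity, each increment of
  \<open>x powr \<beta>\<close> over a unit interval is at least the derivative at the right
  end.\<close>

lemma sum_powr_concave_le:
  assumes "0 < \<beta>" "\<beta> \<le> 1"
  shows "(\<Sum>i=1..n. real i powr (\<beta> - 1)) \<le> real n powr \<beta> / \<beta>"
proof (induction n)
  case (Suc n)
  have "\<beta> * real (Suc n) powr (\<beta> - 1) \<le> real (Suc n) powr \<beta> - real n powr \<beta>"
  proof (cases "n = 0")
    case False
    define N where "N = real n + 1"
    have N: "N > 1" using False by (simp add: N_def)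
    have "(1 - 1 / N) powr \<beta> * 1 powr (1 - \<beta>) \<le> \<beta> * (1 - 1 / N) + (1 - \<beta>) * 1"
      using N assms by (intro Youngs_inequality_0) auto
    then have "N powr \<beta> * (1 - 1 / N) powr \<beta> \<le> N powr \<beta> * (1 - \<beta> / N)"
      by (intro mult_left_mono) (auto simp: algebra_simps)
    also have "N powr \<beta> * (1 - 1 / N) powr \<beta> = (N * (1 - 1 / N)) powr \<beta>"
      using N by (intro powr_mult[symmetric])
    also have "N * (1 - 1 / N) = real n" using N by (simp add: N_def field_simps)
    also have "N powr \<beta> * (1 - \<beta> / N) = N powr \<beta> - \<beta> * N powr (\<beta> - 1)"
      using N by (simp add: powr_diff algebra_simps)
    finally show ?thesis by (simp add: N_def add.commute)
  qed (use assms in auto)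
  then have "real (Suc n) powr (\<beta> - 1) \<le> (real (Suc n) powr \<beta> - real n powr \<beta>) / \<beta>"
    using assms by (simp add: field_simps)
  then show ?case using Suc by (simp add: diff_divide_distrib)
qed simp

text \<open>Convexity of \<open>x powr (- \<beta>)\<close>: its decrease over a unit interval is at
  least the slope at the right end, in absolute value.\<close>

lemma sum_powr_convex_step:
  assumes "\<beta> > 0" "n \<ge> 1"
  shows "\<beta> * real (Suc n) powr (- \<beta> - 1) \<le> real n powr (- \<beta>) - real (Suc n) powr (- \<beta>)"
proof -
  define N where "N = real n + 1"
  have N: "N > 1" using assms by (simp add: N_def)
  have "1 + \<beta> / N \<le> exp (\<beta> / N)" by (rule exp_ge_add_one_self)
  also have "\<dots> \<le> exp (- \<beta> * ln (1 - 1 / N))"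
    using mult_left_mono[OF ln_le_minus_one[of "1 - 1 / N"], of \<beta>] N assms by simp
  also have "\<dots> = (1 - 1 / N) powr (- \<beta>)" using N by (simp add: powr_def)
  finally have "N powr (- \<beta>) * (1 + \<beta> / N) \<le> N powr (- \<beta>) * (1 - 1 / N) powr (- \<beta>)"
    by (intro mult_left_mono) auto
  also have "\<dots> = (N * (1 - 1 / N)) powr (- \<beta>)" using N by (intro powr_mult[symmetric])
  also have "N * (1 - 1 / N) = real n" using N by (simp add: N_def field_simps)
  also have "N powr (- \<beta>) * (1 + \<beta> / N) = N powr (- \<beta>) + \<beta> * N powr (- \<beta> - 1)"
    using N by (simp add: powr_diff algebra_simps)
  finally show ?thesis by (simp add: N_def add.commute)
qed

text \<open>The first \<open>k\<close> terms are constant and add up to at most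
  \<open>k powr (- \<beta>)\<close>; the later ones telescope by
  \<open>sum_powr_convex_step\<close>. The bound with \<open>min\<close> and \<open>max\<close>
  records this split for every \<open>n\<close>, in a form that induction can carry.\<close>

lemma sum_truncated_powr_le:
  assumes "\<beta> > 0" "k \<ge> 1"
  shows "(\<Sum>i=1..n. real (max i k) powr (- \<beta> - 1)) \<le> (1 + 1 / \<beta>) * real k powr (- \<beta>)"
proof -
  have "(\<Sum>i=1..n. real (max i k) powr (- \<beta> - 1))
      \<le> real (min n k) * real k powr (- \<beta> - 1) + (real k powr (- \<beta>) - real (max n k) powr (- \<beta>)) / \<beta>"
  proof (induction n)
    case (Suc n)
    show ?case
    proof (cases "Suc n \<le> k")
      case True
      then show ?thesis using Suc by (simp add: max_def min_def algebra_simps split: if_splits)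
    next
      case False
      have "real (Suc n) powr (- \<beta> - 1) \<le> (real n powr (- \<beta>) - real (Suc n) powr (- \<beta>)) / \<beta>"
        using sum_powr_convex_step[of \<beta> n] assms False by (simp add: field_simps)
      moreover have "max n k = n" "min n k = k" "max (Suc n) k = Suc n" "min (Suc n) k = k"
        using False by auto
      moreover have "(\<Sum>i=1..Suc n. real (max i k) powr (- \<beta> - 1))
          = (\<Sum>i=1..n. real (max i k) powr (- \<beta> - 1)) + real (max (Suc n) k) powr (- \<beta> - 1)"
        by simp
      ultimately show ?thesis using Suc.IH by (simp only: diff_divide_distrib)
    qed
  qed simp
  also have "\<dots> \<le> real k * real k powr (- \<beta> - 1) + real k powr (- \<beta>) / \<beta>"
    using assms by (intro add_mono mult_right_mono divide_right_mono) auto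
  also have "real k * real k powr (- \<beta> - 1) = real k powr (- \<beta>)"
    using assms by (simp add: powr_diff)
  finally show ?thesis by (simp add: algebra_simps)
qed

section \<open>Norms of finitely supported sequences\<close>

lemma decreasing_rearrangement_le:
  assumes "\<And>j. cmod (x j) \<le> B" and "\<And>j. j \<ge> K \<Longrightarrow> x j = 0" and "k \<ge> 1"
  shows "decreasing_rearrangement x k \<le> (if k \<le> K then B else 0)"
proof -
  have bdd: "bdd_below {\<sigma>. 0 \<le> \<sigma> \<and> finite {j. cmod (x j) > \<sigma>} \<and> card {j. cmod (x j) > \<sigma>} < k}"
    by (rule bdd_belowI[of _ 0]) auto
  show ?thesis
  proof (cases "k \<le> K")
    case True
    have "B \<ge> 0" using assms(1)[of 0] norm_ge_zero order_trans by blast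
    moreover have "{j. cmod (x j) > B} = {}" using assms(1) by (auto simp: not_less)
    ultimately show ?thesis
      unfolding decreasing_rearrangement_def using True \<open>k \<ge> 1\<close> by (auto intro!: cInf_lower bdd)
  next
    case False
    have sub: "{j. cmod (x j) > 0} \<subseteq> {..<K}" using assms(2) by (metis lessThan_iff mem_Collect_eq norm_zero not_le order_less_irrefl subsetI)
    then have "finite {j. cmod (x j) > 0}" "card {j. cmod (x j) > 0} \<le> K"
      using finite_subset card_mono[OF _ sub] by auto
    then show ?thesis
      unfolding decreasing_rearrangement_def using False by (auto intro!: cInf_lower bdd)
  qed
qed

text \<open>A crude bound that secures finiteness: a real supremum such as the one in
  \<open>weak_lp_norm\<close> is informative only for a bounded set.\<close>

lemma weak_lp_term_le:
  assumes "\<And>j. cmod (x j) \<le> B" and "\<And>j. j \<ge> K \<Longrightarrow> x j = 0" and "k \<ge> 1" "p > 0"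
  shows "real k powr (1 / p) * decreasing_rearrangement x k \<le> real K powr (1 / p) * B"
proof -
  have B: "B \<ge> 0" using assms(1)[of 0] norm_ge_zero order_trans by blast
  have "real k powr (1 / p) * decreasing_rearrangement x k
      \<le> real k powr (1 / p) * (if k \<le> K then B else 0)"
    by (intro mult_left_mono decreasing_rearrangement_le assms) auto
  also have "\<dots> \<le> real K powr (1 / p) * B"
    using assms(4) B by (auto intro!: mult_right_mono powr_mono2)
  finally show ?thesis .
qed

lemma l2_norm_finite:
  assumes "\<And>j. j \<ge> K \<Longrightarrow> x j = 0"
  shows "l2_norm x = sqrt (\<Sum>j<K. (cmod (x j))\<^sup>2)"
  unfolding l2_norm_def using assms by (subst suminf_finite[of "{..<K}"]) (auto simp: not_less)

lemma S_norm_le: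
  assumes "\<And>j. cmod (x j) \<le> B" and "\<And>j. j \<ge> K \<Longrightarrow> x j = 0" and "p > 0"
  shows "S_norm p x \<le> real K powr (1 / p) * B"
proof (cases "p = 2")
  case True
  have B: "B \<ge> 0" using assms(1)[of 0] norm_ge_zero order_trans by blast
  have "(\<Sum>j<K. (cmod (x j))\<^sup>2) \<le> (\<Sum>j<K. B\<^sup>2)"
    using assms(1) by (intro sum_mono power_mono) auto
  then have "sqrt (\<Sum>j<K. (cmod (x j))\<^sup>2) \<le> sqrt (real K) * B"
    using B by (intro real_le_lsqrt) (auto simp: power_mult_distrib sum_nonneg)
  then show ?thesis using True by (simp add: S_norm_def l2_norm_finite[OF assms(2)] powr_half_sqrt)
next
  case False
  then show ?thesis unfolding S_norm_def weak_lp_norm_def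
    using weak_lp_term_le[of x B K _ p] assms by (auto intro!: cSUP_least)
qed

text \<open>The strict inequality puts the \<open>k\<close>-th rearranged value strictly below the
  threshold, so some admissible \<open>\<sigma>\<close> lies below it too, whether or not the
  infimum is attained.\<close>

lemma card_gt_of_weak_lp_norm_less:
  assumes "\<And>j. cmod (x j) \<le> B" and "\<And>j. j \<ge> K \<Longrightarrow> x j = 0" and "p > 0"
    and "weak_lp_norm p x < H" "k \<ge> 1"
  shows "card {j. cmod (x j) > H * real k powr (- (1 / p))} < k"
proof -
  have "real k powr (1 / p) * decreasing_rearrangement x k \<le> weak_lp_norm p x"
    unfolding weak_lp_norm_def
  proof (rule cSUP_upper)
    show "bdd_above ((\<lambda>k. real k powr (1 / p) * decreasing_rearrangement x k) ` {1..})"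
      by (rule bdd_aboveI2, rule weak_lp_term_le[OF assms(1,2)]) (use assms in auto)
  qed (use assms in auto)
  then have "real k powr (1 / p) * decreasing_rearrangement x k < H" using assms(4) by simp
  then have less: "decreasing_rearrangement x k < H * real k powr (- (1 / p))"
    using \<open>k \<ge> 1\<close> by (simp add: powr_minus divide_inverse[symmetric] pos_less_divide_eq mult.commute)
  have "B \<ge> 0" using assms(1)[of 0] norm_ge_zero order_trans by blast
  moreover have "{j. cmod (x j) > B} = {}" using assms(1) by (auto simp: not_less)
  ultimately have "B \<in> {\<sigma>. 0 \<le> \<sigma> \<and> finite {j. cmod (x j) > \<sigma>} \<and> card {j. cmod (x j) > \<sigma>} < k}"
    using \<open>k \<ge> 1\<close> by simp
  then obtain \<sigma> where \<sigma>: "finite {j. cmod (x j) > \<sigma>}" "card {j. cmod (x j) > \<sigma>} < k"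
      "\<sigma> < H * real k powr (- (1 / p))"
    using cInf_lessD[OF _ less[unfolded decreasing_rearrangement_def]] by blast
  have "card {j. cmod (x j) > H * real k powr (- (1 / p))} \<le> card {j. cmod (x j) > \<sigma>}"
    using \<sigma> by (intro card_mono) auto
  then show ?thesis using \<sigma> by simp
qed

context prob_space
begin

text \<open>The factor \<open>sqrt 8\<close> makes the tail exponent at level \<open>sqrt k\<close>
  equal to \<open>- 2 * k\<close>, as \<open>nn_integral_exp_powr_le_18\<close> expects.\<close>

lemma nn_integral_exp_sum_le_l2:
  assumes indep: "indep_vars (\<lambda>_. borel) \<gamma> (UNIV :: nat set)"
    and sub: "\<And>j. complex_subgaussian_bound M s (\<gamma> j)"
    and "s > 0" "H > 0" "sqrt (\<Sum>j<K. (cmod (c j))\<^sup>2) \<le> H"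
  shows "(\<integral>\<^sup>+ \<omega>. ennreal (exp ((\<bar>cmod (\<Sum>j<K. \<gamma> j \<omega> * c j)\<bar> / (sqrt 8 * s * H)) powr 2)) \<partial>M) \<le> 18"
proof -
  have [measurable]: "\<gamma> j \<in> borel_measurable M" for j
    using indep by (auto simp: indep_vars_def)
  define Y where "Y = (\<lambda>\<omega>. \<Sum>j<K. \<gamma> j \<omega> * c j)"
  have Y_meas [measurable]: "Y \<in> borel_measurable M" unfolding Y_def by measurable
  have Y_sub: "complex_subgaussian_bound M (s * H) Y" unfolding Y_def
    by (rule complex_subgaussian_bound_mono[OF complex_subgaussian_bound_sum[OF indep sub]])
       (use assms in auto)
  have "(\<integral>\<^sup>+ \<omega>. ennreal (exp ((\<bar>cmod (Y \<omega>)\<bar> / (sqrt 8 * s * H)) powr 2)) \<partial>M) \<le> 18"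
  proof (rule nn_integral_exp_powr_le_18)
    fix k :: nat
    have "(sqrt 8 * s * H * real k powr (1 / 2))\<^sup>2 / (4 * (s * H)\<^sup>2) = 2 * real k"
      using assms by (simp add: power_mult_distrib powr_half_sqrt)
    then show "emeasure M {\<omega>\<in>space M. \<bar>cmod (Y \<omega>)\<bar> \<ge> sqrt 8 * s * H * real k powr (1 / 2)}
        \<le> ennreal (4 * exp (- 2 * real k))"
      using complex_subgaussian_bound_tail[OF Y_meas Y_sub, of "sqrt 8 * s * H * real k powr (1 / 2)"] assms
      by simp
  qed (use assms in auto)
  then show ?thesis by (simp add: Y_def)
qed

text \<open>
  At level \<open>k powr (1 / r)\<close>, the fewer than \<open>k\<close> large coefficients are controlled by the uniform
  bound \<open>L\<close> and the remaining ones by the subgaussian tail.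
\<close>

lemma nn_integral_exp_sum_le_weak:
  fixes r :: real
  assumes indep: "indep_vars (\<lambda>_. borel) \<gamma> (UNIV :: nat set)"
    and sub: "\<And>j. complex_subgaussian_bound M s (\<gamma> j)"
    and bound: "\<And>j. AE \<omega> in M. cmod (\<gamma> j \<omega>) \<le> L" and "L \<ge> 0"
    and "s > 0" "H > 0" "r > 2"
    and card: "\<And>k. k \<ge> 1 \<Longrightarrow> card {j\<in>{..<K}. cmod (c j) > H * real k powr (1 / r - 1)} < k"
  shows "(\<integral>\<^sup>+ \<omega>. ennreal (exp ((\<bar>cmod (\<Sum>j<K. \<gamma> j \<omega> * c j)\<bar>
      / ((L * r + s * sqrt (8 * (1 + r / (r - 2)))) * H)) powr r)) \<partial>M) \<le> 18"
proof (rule nn_integral_exp_powr_le_18)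
  have [measurable]: "\<gamma> j \<in> borel_measurable M" for j
    using indep by (auto simp: indep_vars_def)
  show "(\<lambda>\<omega>. cmod (\<Sum>j<K. \<gamma> j \<omega> * c j)) \<in> borel_measurable M" by measurable
  show "r > 0" using assms by simp
  \<comment> \<open>This is \<open>1 + 1 / \<beta>\<close> of \<open>sum_truncated_powr_le\<close>
    for \<open>\<beta> = 1 - 2 / r\<close>. It blows up as \<open>r\<close> tends to 2, where the
    weak norm ceases to control the l2 norm.\<close>
  define B where "B = 1 + r / (r - 2)"
  have B: "B > 0" using \<open>r > 2\<close> by (simp add: B_def add_pos_pos)
  have "0 < s * sqrt (8 * B)" using \<open>s > 0\<close> B by simp
  then show "0 < (L * r + s * sqrt (8 * (1 + r / (r - 2)))) * H"
    unfolding B_def using assms by (simp add: add_nonneg_pos)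
  fix k :: nat assume k: "k \<ge> 1"
  define \<tau> where "\<tau> = (\<lambda>i::nat. H * real i powr (1 / r - 1))"
  have \<tau>_nonneg: "\<tau> i \<ge> 0" for i using \<open>H > 0\<close> by (simp add: \<tau>_def)
  define J where "J = {j\<in>{..<K}. cmod (c j) > \<tau> k}"
  define c1 where "c1 = (\<lambda>j. if j \<in> J then c j else 0)"
  define c2 where "c2 = (\<lambda>j. if j \<in> J then 0 else c j)"
  define Y2 where "Y2 = (\<lambda>\<omega>. \<Sum>j<K. \<gamma> j \<omega> * c2 j)"
  have Y2_meas [measurable]: "Y2 \<in> borel_measurable M" unfolding Y2_def by measurable
  have J: "finite J" "card J < k" using card[OF k] by (auto simp: J_def \<tau>_def)
  have "(\<Sum>j\<in>J. cmod (c j)) \<le> (\<Sum>i=1..card J. \<tau> i)"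
  proof (rule sum_le_sum_of_card_less[OF J(1), of "\<lambda>x. x"])
    show "mono_on {0..} (\<lambda>x::real. x)" by (auto intro: mono_onI)
    fix i :: nat assume "i \<ge> 1"
    have "card {j\<in>J. cmod (c j) > \<tau> i} \<le> card {j\<in>{..<K}. cmod (c j) > \<tau> i}"
      by (intro card_mono) (auto simp: J_def)
    then show "card {j\<in>J. cmod (c j) > \<tau> i} < i" using card[OF \<open>i \<ge> 1\<close>] by (simp add: \<tau>_def)
  qed (auto simp: \<tau>_nonneg)
  also have "\<dots> = H * (\<Sum>i=1..card J. real i powr (1 / r - 1))"
    by (simp add: \<tau>_def sum_distrib_left)
  also have "\<dots> \<le> H * (real (card J) powr (1 / r) / (1 / r))"
    using assms by (intro mult_left_mono sum_powr_concave_le) auto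
  also have "\<dots> \<le> H * (real k powr (1 / r) / (1 / r))"
    using assms J by (intro mult_left_mono divide_right_mono powr_mono2) auto
  finally have sum_J: "(\<Sum>j\<in>J. cmod (c j)) \<le> H * r * real k powr (1 / r)" by (simp add: mult_ac)

  have "AE \<omega> in M. \<forall>j. cmod (\<gamma> j \<omega>) \<le> L" using bound by (simp add: AE_all_countable)
  then have big: "AE \<omega> in M. cmod (\<Sum>j<K. \<gamma> j \<omega> * c j) \<le> L * r * H * real k powr (1 / r) + cmod (Y2 \<omega>)"
  proof eventually_elim
    case (elim \<omega>)
    have "(\<Sum>j<K. \<gamma> j \<omega> * c j) = (\<Sum>j<K. \<gamma> j \<omega> * c1 j) + Y2 \<omega>"
      unfolding Y2_def sum.distrib[symmetric] by (rule sum.cong) (auto simp: c1_def c2_def)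
    moreover have "cmod (\<Sum>j<K. \<gamma> j \<omega> * c1 j) \<le> L * r * H * real k powr (1 / r)"
    proof -
      have "cmod (\<Sum>j<K. \<gamma> j \<omega> * c1 j) \<le> (\<Sum>j<K. L * cmod (c1 j))"
        using elim by (intro order_trans[OF norm_sum sum_mono]) (simp add: norm_mult mult_right_mono)
      also have "\<dots> = L * (\<Sum>j<K. if j \<in> J then cmod (c j) else 0)"
        unfolding sum_distrib_left by (rule sum.cong) (auto simp: c1_def)
      also have "(\<Sum>j<K. if j \<in> J then cmod (c j) else 0) = (\<Sum>j\<in>J. cmod (c j))"
        by (subst sum.inter_restrict[symmetric]) (auto simp: J_def intro!: sum.cong)
      also have "L * \<dots> \<le> L * (H * r * real k powr (1 / r))"
        using sum_J \<open>L \<ge> 0\<close> by (rule mult_left_mono)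
      finally show ?thesis by (simp add: mult_ac)
    qed
    ultimately show ?case
      using norm_triangle_ineq[of "\<Sum>j<K. \<gamma> j \<omega> * c1 j" "Y2 \<omega>"] by simp
  qed

  \<comment> \<open>Coefficients outside \<open>J\<close> are at most \<open>\<tau> k\<close>, so
    truncation at \<open>\<tau> k\<close> leaves them whole. The truncated square is monotone, which
    allows replacing the coefficients by the thresholds \<open>\<tau> i\<close>.\<close>
  have "(\<Sum>j<K. (cmod (c2 j))\<^sup>2) \<le> (\<Sum>j<K. (min (cmod (c j)) (\<tau> k))\<^sup>2)"
    using \<tau>_nonneg by (intro sum_mono power_mono) (auto simp: c2_def J_def not_less)
  also have "\<dots> \<le> (\<Sum>i=1..card {..<K}. (min (\<tau> i) (\<tau> k))\<^sup>2)"
  proof (rule sum_le_sum_of_card_less[of "{..<K}" "\<lambda>x. (min x (\<tau> k))\<^sup>2" "\<lambda>j. cmod (c j)" \<tau>])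
    show "mono_on {0..} (\<lambda>x. (min x (\<tau> k))\<^sup>2)"
      using \<tau>_nonneg by (intro mono_onI power_mono) auto
  qed (use card \<tau>_nonneg in \<open>auto simp: \<tau>_def\<close>)
  also have "\<dots> \<le> (\<Sum>i=1..K. H\<^sup>2 * real (max i k) powr (- (1 - 2 / r) - 1))"
    unfolding card_lessThan
  proof (rule sum_mono)
    fix i assume "i \<in> {1..K}"
    have "min (\<tau> i) (\<tau> k) \<le> \<tau> (max i k)" by (auto simp: max_def min_def)
    then have "(min (\<tau> i) (\<tau> k))\<^sup>2 \<le> (\<tau> (max i k))\<^sup>2"
      using \<tau>_nonneg by (intro power_mono) auto
    also have "\<dots> = H\<^sup>2 * real (max i k) powr (2 * (1 / r - 1))"
      by (simp add: \<tau>_def power_mult_distrib power2_eq_square flip: powr_add)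
    also have "2 * (1 / r - 1) = - (1 - 2 / r) - 1" by simp
    finally show "(min (\<tau> i) (\<tau> k))\<^sup>2 \<le> H\<^sup>2 * real (max i k) powr (- (1 - 2 / r) - 1)" .
  qed
  also have "\<dots> = H\<^sup>2 * (\<Sum>i=1..K. real (max i k) powr (- (1 - 2 / r) - 1))"
    by (simp only: sum_distrib_left)
  also have "\<dots> \<le> H\<^sup>2 * ((1 + 1 / (1 - 2 / r)) * real k powr (- (1 - 2 / r)))"
    using assms k by (intro mult_left_mono sum_truncated_powr_le) (auto simp: field_simps)
  also have "1 + 1 / (1 - 2 / r) = B" using \<open>r > 2\<close> by (simp add: B_def field_simps)
  also have "real k powr (- (1 - 2 / r)) = (real k powr (1 / r - 1 / 2))\<^sup>2"
    by (simp add: power2_eq_square flip: powr_add)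
  finally have "(\<Sum>j<K. (cmod (c2 j))\<^sup>2) \<le> (H * sqrt B * real k powr (1 / r - 1 / 2))\<^sup>2"
    using B by (simp add: power_mult_distrib)
  then have small: "sqrt (\<Sum>j<K. (cmod (c2 j))\<^sup>2) \<le> H * sqrt B * real k powr (1 / r - 1 / 2)"
    using assms B by (intro real_le_lsqrt) (auto simp: sum_nonneg)

  \<comment> \<open>The level \<open>u\<close> below is \<open>sqrt (8 * k) * \<sigma>\<close>, so
    the tail exponent is again \<open>- 2 * k\<close>; the factor \<open>sqrt k\<close> lifts the
    power \<open>1 / r - 1 / 2\<close> to \<open>1 / r\<close>, the order of the part over
    \<open>J\<close>.\<close>
  define \<sigma> where "\<sigma> = s * (H * sqrt B * real k powr (1 / r - 1 / 2))"
  have Y2_sub: "complex_subgaussian_bound M \<sigma> Y2"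
    unfolding Y2_def \<sigma>_def
    by (rule complex_subgaussian_bound_mono[OF complex_subgaussian_bound_sum[OF indep sub] mult_left_mono[OF small]])
       (use assms in auto)
  define u where "u = s * sqrt (8 * B) * H * real k powr (1 / r)"
  have "\<sigma> > 0" "u \<ge> 0" using assms B k by (auto simp: \<sigma>_def u_def)
  have "real k powr (1 / r) = real k powr (1 / r - 1 / 2) * sqrt (real k)"
    using k by (simp add: powr_half_sqrt[symmetric] flip: powr_add)
  then have "u = sqrt 8 * sqrt (real k) * \<sigma>"
    using B by (simp add: u_def \<sigma>_def real_sqrt_mult mult_ac)
  then have "u\<^sup>2 / (4 * \<sigma>\<^sup>2) = 2 * real k"
    using \<open>\<sigma> > 0\<close> by (simp add: power_mult_distrib)
  have "emeasure M {\<omega>\<in>space M. \<bar>cmod (\<Sum>j<K. \<gamma> j \<omega> * c j)\<bar>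
        \<ge> (L * r + s * sqrt (8 * B)) * H * real k powr (1 / r)}
      \<le> emeasure M {\<omega>\<in>space M. cmod (Y2 \<omega>) \<ge> u}"
  proof (rule emeasure_mono_AE)
    show "AE \<omega> in M. \<omega> \<in> {\<omega>\<in>space M. \<bar>cmod (\<Sum>j<K. \<gamma> j \<omega> * c j)\<bar>
          \<ge> (L * r + s * sqrt (8 * B)) * H * real k powr (1 / r)} \<longrightarrow>
        \<omega> \<in> {\<omega>\<in>space M. cmod (Y2 \<omega>) \<ge> u}"
      using big by eventually_elim (auto simp: u_def algebra_simps)
  qed measurable
  also have "\<dots> \<le> ennreal (4 * exp (- u\<^sup>2 / (4 * \<sigma>\<^sup>2)))"
    by (rule complex_subgaussian_bound_tail[OF Y2_meas Y2_sub \<open>\<sigma> > 0\<close> \<open>u \<ge> 0\<close>])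
  also have "- u\<^sup>2 / (4 * \<sigma>\<^sup>2) = - 2 * real k"
    using \<open>u\<^sup>2 / (4 * \<sigma>\<^sup>2) = 2 * real k\<close> by simp
  finally show "emeasure M {\<omega>\<in>space M. \<bar>cmod (\<Sum>j<K. \<gamma> j \<omega> * c j)\<bar>
        \<ge> (L * r + s * sqrt (8 * (1 + r / (r - 2)))) * H * real k powr (1 / r)}
      \<le> ennreal (4 * exp (- 2 * real k))"
    by (simp only: B_def)
qed

end

subsection \<open>The random Dirichlet polynomial\<close>

lemma (in prob_space) luxemburg_norm_sup_dirichlet_le:
  fixes r :: real and D :: "nat \<Rightarrow> complex \<Rightarrow> complex"
  assumes "r > 0" "c > 0" "finite A" "0 \<notin> A" and D: "\<And>j. j < K \<Longrightarrow> D j \<in> dirichlet_polys A"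
    and [measurable]: "\<And>j. \<gamma> j \<in> borel_measurable M"
    and int: "\<And>t::real. (\<integral>\<^sup>+ \<omega>. ennreal (exp ((\<bar>cmod (\<Sum>j<K. \<gamma> j \<omega> * D j (\<i> * of_real t))\<bar> / c) powr r)) \<partial>M) \<le> 18"
  shows "luxemburg_norm M r (\<lambda>\<omega>. SUP t::real. cmod (\<Sum>j<K. \<gamma> j \<omega> * D j (\<i> * of_real t)))
    \<le> ennreal (2 * c * (7 * (1 + real (prime_counting_set A) * (1 + 20 * ln (real (big_omega_set A))))) powr (1 / r))"
proof -
  define m where "m = max 1 (big_omega_set A)"
  define N where "N = prime_counting_set A"
  have m: "m \<ge> 1" by (simp add: m_def)
  \<comment> \<open>If \<open>big_omega_set A\<close> is 0, both sides vanish because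
    \<open>ln 0 = 0\<close>.\<close>
  have ln_m: "ln (real (big_omega_set A)) = ln (real m)"
    by (cases "big_omega_set A = 0") (auto simp: m_def max_def)
  \<comment> \<open>Since 18 and 80 are below \<open>2 powr 7\<close> and
    \<open>m \<le> 2 powr (140 * ln m)\<close>, the union bound \<open>18 * (80 * m) ^ N\<close> is
    at most \<open>2 powr \<Lambda>\<close>. The generous 140 is \<open>7 * 20\<close>, so that
    \<open>\<Lambda>\<close> is 7 times the factor in the theorem.\<close>
  define \<Lambda> where "\<Lambda> = 7 * (1 + real N * (1 + 20 * ln (real m)))"
  have "real N * (1 + 20 * ln (real m)) \<ge> 0" using m by simp
  then have "\<Lambda> \<ge> 2" by (simp add: \<Lambda>_def)
  obtain T :: "real set" where T: "finite T" "T \<noteq> {}" "card T \<le> (80 * m) ^ N"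
    and net: "\<And>D c t. D \<in> dirichlet_polys A \<Longrightarrow> (\<And>t. t \<in> T \<Longrightarrow> cmod (D (\<i> * of_real t)) \<le> c) \<Longrightarrow>
       cmod (D (\<i> * of_real t)) \<le> 2 * c"
    using dirichlet_polys_net[OF assms(3,4)] unfolding m_def N_def by blast
  have "real m \<le> 2 powr (140 * ln (real m))"
  proof -
    have "ln (real m) * 1 \<le> ln (real m) * (140 * ln 2)"
      using m ln2_ge_two_thirds by (intro mult_left_mono) auto
    then have "exp (ln (real m)) \<le> exp (140 * ln (real m) * ln 2)" by (simp add: mult_ac)
    then show ?thesis using m by (simp add: powr_def)
  qed
  then have "real (80 * m) \<le> 2 powr 7 * 2 powr (140 * ln (real m))"
    unfolding of_nat_mult by (intro mult_mono) auto
  then have "real (80 * m) ^ N \<le> (2 powr (7 + 140 * ln (real m))) ^ N"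
    by (intro power_mono) (auto simp: powr_add)
  also have "\<dots> = 2 powr (real N * (7 + 140 * ln (real m)))"
    by (simp add: powr_power mult.commute)
  finally have "18 * real (card T) \<le> 2 powr 7 * 2 powr (real N * (7 + 140 * ln (real m)))"
    using T(3) by (intro mult_mono) (auto simp flip: of_nat_power of_nat_mult intro: order_trans[OF of_nat_mono])
  also have "\<dots> = 2 powr \<Lambda>" unfolding powr_add[symmetric] by (simp add: \<Lambda>_def algebra_simps)
  finally have card: "18 * real (card T) \<le> 2 powr \<Lambda>" .
  have "luxemburg_norm M r (\<lambda>\<omega>. SUP t::real. cmod (\<Sum>j<K. \<gamma> j \<omega> * D j (\<i> * of_real t)))
    \<le> ennreal (2 * c * \<Lambda> powr (1 / r))"
  proof (rule luxemburg_norm_max_le[OF T(1) _ assms(1,2) \<open>\<Lambda> \<ge> 2\<close> card int])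
    fix \<omega>
    define E where "E = (\<lambda>s. \<Sum>j<K. \<gamma> j \<omega> * D j s)"
    have E: "E \<in> dirichlet_polys A" unfolding E_def by (rule sum_in_dirichlet_polys) (rule D)
    define f where "f = (\<lambda>t::real. cmod (E (\<i> * of_real t)))"
    obtain B where "\<And>t. f t \<le> B" using dirichlet_polys_bounded[OF E] unfolding f_def by blast
    then have bdd: "bdd_above (range f)" by (rule bdd_aboveI2)
    have "Max (f ` T) \<in> f ` T" using T by (intro Max_in) auto
    then obtain t where t: "t \<in> T" "f t = Max (f ` T)" by auto
    have "f t' \<le> 2 * f t" for t'
      unfolding f_def
    proof (rule net[OF E])
      fix t' assume "t' \<in> T"
      then show "cmod (E (\<i> * of_real t')) \<le> cmod (E (\<i> * of_real t))"
        using Max_ge[of "f ` T" "f t'"] T t(2) by (simp add: f_def)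
    qed
    then have "(SUP t. f t) \<le> 2 * f t" by (intro cSUP_least) auto
    moreover have "0 \<le> f 0" by (simp add: f_def)
    then have "0 \<le> (SUP t. f t)" using cSUP_upper[OF UNIV_I bdd, of 0] by linarith
    ultimately have "\<bar>SUP t. f t\<bar> \<le> 2 * \<bar>f t\<bar>" by linarith
    then show "\<exists>t\<in>T. \<bar>SUP t::real. cmod (\<Sum>j<K. \<gamma> j \<omega> * D j (\<i> * of_real t))\<bar>
        \<le> 2 * \<bar>cmod (\<Sum>j<K. \<gamma> j \<omega> * D j (\<i> * of_real t))\<bar>"
      using t(1) unfolding f_def E_def by blast
  qed measurable
  then show ?thesis by (simp only: \<Lambda>_def N_def ln_m)
qed

text \<open>The estimates are made for each \<open>H\<close> strictly above the supremum of the
  norms: \<open>H\<close> must be positive even if all norms vanish, and the counting of large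
  coefficients needs a strict inequality. This limit closes the gap.\<close>

lemma ennreal_mult_le_of_forall_greater:
  assumes "C \<ge> 0" "\<And>h. h > x \<Longrightarrow> y \<le> ennreal (C * h)"
  shows "y \<le> ennreal (C * x)"
proof (rule ennreal_le_epsilon)
  fix e :: real assume "e > 0"
  have "y \<le> ennreal (C * (x + e / (C + 1)))" using assms \<open>e > 0\<close> by simp
  also have "\<dots> \<le> ennreal (C * x + e)"
  proof (rule ennreal_leI)
    have "C * (e / (C + 1)) \<le> (C + 1) * (e / (C + 1))" using assms \<open>e > 0\<close> by (intro mult_right_mono) auto
    then show "C * (x + e / (C + 1)) \<le> C * x + e" using assms(1) by (simp add: distrib_left)
  qed
  also have "\<dots> \<le> ennreal (C * x) + ennreal e"
    using \<open>e > 0\<close> by (cases "C * x \<ge> 0") (auto simp: ennreal_plus ennreal_neg intro: ennreal_leI)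
  finally show "y \<le> ennreal (C * x) + ennreal e" .
qed

text \<open>Common to \<open>r = 2\<close> and \<open>r > 2\<close>: only the exponential moment at
  a fixed \<open>t\<close> remains to be supplied. The a priori bound \<open>B\<close> is passed on
  in \<open>int\<close> because the weak norm estimates rely on it.\<close>

lemma (in prob_space) luxemburg_norm_sup_dirichlet_le_S_norm:
  fixes r :: real and D :: "nat \<Rightarrow> complex \<Rightarrow> complex"
  defines "E \<equiv> \<lambda>A. (1 + real (prime_counting_set A) * (1 + 20 * ln (real (big_omega_set A))))"
    and "x \<equiv> \<lambda>K D t j. if j < K then D j (\<i> * of_real t) else 0"
  assumes "r \<ge> 2" "c > 0" "finite A" "0 \<notin> A" and D: "\<forall>j<K. D j \<in> dirichlet_polys A"
    and meas: "\<And>j. \<gamma> j \<in> borel_measurable M"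
    and int: "\<And>(t :: real) H B. 0 < H \<Longrightarrow> S_norm (conj_exponent r) (x K D t) < H \<Longrightarrow>
      (\<And>j. cmod (x K D t j) \<le> B) \<Longrightarrow>
      (\<integral>\<^sup>+ \<omega>. ennreal (exp ((\<bar>cmod (\<Sum>j<K. \<gamma> j \<omega> * D j (\<i> * of_real t))\<bar> / (c * H)) powr r)) \<partial>M) \<le> 18"
  shows "luxemburg_norm M r (\<lambda>\<omega>. SUP t::real. cmod (\<Sum>j<K. \<gamma> j \<omega> * D j (\<i> * of_real t)))
    \<le> ennreal (14 * c * E A powr (1 / r) * (SUP t::real. S_norm (conj_exponent r) (x K D t)))"
proof (rule ennreal_mult_le_of_forall_greater)
  have p: "conj_exponent r > 0" using \<open>r \<ge> 2\<close> by (simp add: conj_exponent_def)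
  have "\<forall>j\<in>{..<K}. \<exists>B. \<forall>t::real. cmod (D j (\<i> * of_real t)) \<le> B"
    using D dirichlet_polys_bounded by (metis lessThan_iff)
  then obtain b where b: "\<And>j t. j < K \<Longrightarrow> cmod (D j (\<i> * of_real t)) \<le> b j" by (metis lessThan_iff)
  define B where "B = (\<Sum>j<K. \<bar>b j\<bar>)"
  have B: "cmod (x K D t j) \<le> B" for t j
  proof (cases "j < K")
    case True
    then have "cmod (x K D t j) \<le> \<bar>b j\<bar>" using b[OF True, of t] by (simp add: x_def)
    also have "\<dots> \<le> B" unfolding B_def using True by (intro member_le_sum) auto
    finally show ?thesis .
  qed (simp add: x_def B_def sum_nonneg)
  have le: "S_norm (conj_exponent r) (x K D t) \<le> real K powr (1 / conj_exponent r) * B" for t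
    using B p by (intro S_norm_le) (auto simp: x_def)
  have nonneg: "0 \<le> S_norm (conj_exponent r) (x K D t)" for t
  proof (cases "conj_exponent r = 2")
    case True
    then show ?thesis by (simp add: S_norm_def l2_norm_finite[of K] x_def sum_nonneg)
  next
    case False
    have "0 \<le> real 1 powr (1 / conj_exponent r) * decreasing_rearrangement (x K D t) 1"
    proof -
      have "{\<sigma>. 0 \<le> \<sigma> \<and> finite {j. cmod (x K D t j) > \<sigma>} \<and> card {j. cmod (x K D t j) > \<sigma>} < 1} \<noteq> {}"
      proof -
        have "{j. cmod (x K D t j) > B} = {}" using B by (auto simp: not_less)
        moreover have "B \<ge> 0" by (simp add: B_def sum_nonneg)
        ultimately show ?thesis by (intro ex_in_conv[THEN iffD1] exI[of _ B]) simp
      qed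
      then show ?thesis unfolding decreasing_rearrangement_def by (auto intro!: cInf_greatest)
    qed
    also have "\<dots> \<le> weak_lp_norm (conj_exponent r) (x K D t)"
      unfolding weak_lp_norm_def
    proof (rule cSUP_upper)
      show "bdd_above ((\<lambda>k. real k powr (1 / conj_exponent r) * decreasing_rearrangement (x K D t) k) ` {1..})"
        by (rule bdd_aboveI2, rule weak_lp_term_le[where K = K and B = B]) (use B p in \<open>auto simp: x_def\<close>)
    qed auto
    finally show ?thesis using False by (simp add: S_norm_def)
  qed
  have bdd: "bdd_above (range (\<lambda>t. S_norm (conj_exponent r) (x K D t)))"
    using le by (rule bdd_aboveI2)
  fix H assume "H > (SUP t::real. S_norm (conj_exponent r) (x K D t))"
  then have less: "S_norm (conj_exponent r) (x K D t) < H" for t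
    using cSUP_upper[OF UNIV_I bdd, of t] by linarith
  then have "H > 0" using nonneg[of 0] less[of 0] by linarith
  have "luxemburg_norm M r (\<lambda>\<omega>. SUP t::real. cmod (\<Sum>j<K. \<gamma> j \<omega> * D j (\<i> * of_real t)))
    \<le> ennreal (2 * (c * H) * (7 * E A) powr (1 / r))"
    unfolding E_def using \<open>r \<ge> 2\<close> \<open>c > 0\<close> \<open>H > 0\<close> D
    by (intro luxemburg_norm_sup_dirichlet_le assms meas int[OF _ less B]) auto
  also have "\<dots> \<le> ennreal (14 * c * E A powr (1 / r) * H)"
  proof (rule ennreal_leI)
    \<comment> \<open>Bounding \<open>7 powr (1 / r)\<close> by 7 gives the constant
      \<open>14 = 2 * 7\<close>.\<close>
    have "(7::real) powr (1 / r) \<le> 7 powr 1" using \<open>r \<ge> 2\<close> by (intro powr_mono) auto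
    have "(7 * E A) powr (1 / r) = 7 powr (1 / r) * E A powr (1 / r)" by (rule powr_mult)
    also have "\<dots> \<le> 7 * E A powr (1 / r)"
      using \<open>(7::real) powr (1 / r) \<le> 7 powr 1\<close> by (intro mult_right_mono) auto
    finally have "2 * (c * H) * (7 * E A) powr (1 / r) \<le> 2 * (c * H) * (7 * E A powr (1 / r))"
      using \<open>c > 0\<close> \<open>H > 0\<close> by (intro mult_left_mono) auto
    then show "2 * (c * H) * (7 * E A) powr (1 / r) \<le> 14 * c * E A powr (1 / r) * H" by (simp add: mult_ac)
  qed
  finally show "luxemburg_norm M r (\<lambda>\<omega>. SUP t::real. cmod (\<Sum>j<K. \<gamma> j \<omega> * D j (\<i> * of_real t)))
    \<le> ennreal (14 * c * E A powr (1 / r) * H)" .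
qed (use \<open>c > 0\<close> in auto)

theorem theorem8p1:
  "\<exists>(C2 :: real \<Rightarrow> real) (C :: real \<Rightarrow> real \<Rightarrow> real \<Rightarrow> real).
     (\<forall>s. C2 s > 0) \<and> (\<forall>r s M. C r s M > 0) \<and>
     (\<forall>(r :: real) (s :: real) (M :: real) (P :: 'a measure) (\<gamma> :: nat \<Rightarrow> 'a \<Rightarrow> complex)
        (A :: nat set) (K :: nat) (D :: nat \<Rightarrow> complex \<Rightarrow> complex).
        2 \<le> r \<longrightarrow>
        prob_space P \<longrightarrow>
        prob_space.indep_vars P (\<lambda>_. borel) \<gamma> UNIV \<longrightarrow>
        subgaussian_sequence P \<gamma> s \<longrightarrow>
        (r > 2 \<longrightarrow> 0 \<le> M \<and> (SUP j. esssup P (\<lambda>\<omega>. ennreal (cmod (\<gamma> j \<omega>)))) = ennreal M) \<longrightarrow>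
        finite A \<longrightarrow> 0 \<notin> A \<longrightarrow>
        (\<forall>j<K. D j \<in> dirichlet_polys A) \<longrightarrow>
        luxemburg_norm P r (\<lambda>\<omega>. SUP t::real. cmod (\<Sum>j<K. \<gamma> j \<omega> * D j (\<i> * of_real t)))
          \<le> ennreal ((if r = 2 then C2 s else C r s M)
              * (1 + real (prime_counting_set A) * (1 + 20 * ln (real (big_omega_set A)))) powr (1 / r)
              * (SUP t::real. S_norm (conj_exponent r) (\<lambda>j. if j < K then D j (\<i> * of_real t) else 0))))"
proof -
  \<comment> \<open>Both constants precede the probability space and must be positive for all real
    arguments, hence the absolute values. The summand 1 next to \<open>\<bar>s\<bar>\<close> pays
    for \<open>subgaussian_sequence_bound\<close>.\<close>
  define C2 where "C2 = (\<lambda>s::real. sqrt 8 * (\<bar>s\<bar> + 1))"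
  define C where "C = (\<lambda>r s M::real. \<bar>M\<bar> * \<bar>r\<bar> + (\<bar>s\<bar> + 1) * sqrt (8 * (1 + \<bar>r / (r - 2)\<bar>)))"
  have C2_pos: "C2 s > 0" for s by (simp add: C2_def add_nonneg_pos)
  have C_pos: "C r s M > 0" for r s M
  proof -
    have "0 < (\<bar>s\<bar> + 1) * sqrt (8 * (1 + \<bar>r / (r - 2)\<bar>))"
      by (intro mult_pos_pos) (auto simp: add_nonneg_pos add_pos_nonneg)
    then show ?thesis by (simp add: C_def add_nonneg_pos)
  qed
  show ?thesis
  proof (intro exI[of _ "\<lambda>s. 14 * C2 s"] exI[of _ "\<lambda>r s M. 14 * C r s M"] conjI allI impI)
    show "14 * C2 s > 0" for s using C2_pos by simp
    show "14 * C r s M > 0" for r s M using C_pos by simp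
  next
    fix r s L :: real and P :: "'a measure" and \<gamma> :: "nat \<Rightarrow> 'a \<Rightarrow> complex"
      and A :: "nat set" and K :: nat and D :: "nat \<Rightarrow> complex \<Rightarrow> complex"
    assume r: "2 \<le> r" and P: "prob_space P" and indep: "prob_space.indep_vars P (\<lambda>_. borel) \<gamma> UNIV"
      and sub: "subgaussian_sequence P \<gamma> s"
      and L: "r > 2 \<longrightarrow> 0 \<le> L \<and> (SUP j. esssup P (\<lambda>\<omega>. ennreal (cmod (\<gamma> j \<omega>)))) = ennreal L"
      and A: "finite A" "0 \<notin> A" and D: "\<forall>j<K. D j \<in> dirichlet_polys A"
    interpret prob_space P by fact
    define \<sigma> where "\<sigma> = \<bar>s\<bar> + 1"
    have "\<sigma> > 0" by (simp add: \<sigma>_def)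
    have sub': "complex_subgaussian_bound P \<sigma> (\<gamma> j)" for j
      by (rule complex_subgaussian_bound_mono[OF subgaussian_sequence_bound[OF sub]]) (simp add: \<sigma>_def)
    have meas [measurable]: "\<gamma> j \<in> borel_measurable P" for j
      using indep by (auto simp: indep_vars_def)
    define c where "c = (if r = 2 then C2 s else C r s L)"
    have "luxemburg_norm P r (\<lambda>\<omega>. SUP t::real. cmod (\<Sum>j<K. \<gamma> j \<omega> * D j (\<i> * of_real t)))
          \<le> ennreal (14 * c
              * (1 + real (prime_counting_set A) * (1 + 20 * ln (real (big_omega_set A)))) powr (1 / r)
              * (SUP t::real. S_norm (conj_exponent r) (\<lambda>j. if j < K then D j (\<i> * of_real t) else 0)))"
    proof (rule luxemburg_norm_sup_dirichlet_le_S_norm[OF r _ A D meas])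
      show "c > 0" using C2_pos C_pos by (simp add: c_def)
      fix t H B :: real
      define x where "x = (\<lambda>j. if j < K then D j (\<i> * of_real t) else 0)"
      assume H: "0 < H" and norm: "S_norm (conj_exponent r) (\<lambda>j. if j < K then D j (\<i> * of_real t) else 0) < H"
        and B: "\<And>j. cmod (if j < K then D j (\<i> * of_real t) else 0) \<le> B"
      have norm: "S_norm (conj_exponent r) x < H" using norm by (simp add: x_def)
      have x0: "x j = 0" if "j \<ge> K" for j using that by (simp add: x_def)
      have B: "cmod (x j) \<le> B" for j using B by (simp add: x_def)
      have x_eq: "(\<Sum>j<K. \<gamma> j \<omega> * D j (\<i> * of_real t)) = (\<Sum>j<K. \<gamma> j \<omega> * x j)" for \<omega>
        by (simp add: x_def)
      show "(\<integral>\<^sup>+ \<omega>. ennreal (exp ((\<bar>cmod (\<Sum>j<K. \<gamma> j \<omega> * D j (\<i> * of_real t))\<bar> / (c * H)) powr r)) \<partial>P) \<le> 18"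
      proof (cases "r = 2")
        case True
        have "conj_exponent r = 2" by (simp add: True conj_exponent_def)
        then have "sqrt (\<Sum>j<K. (cmod (x j))\<^sup>2) \<le> H"
          using norm by (simp add: S_norm_def l2_norm_finite[OF x0])
        then show ?thesis
          unfolding x_eq using nn_integral_exp_sum_le_l2[OF indep sub' \<open>\<sigma> > 0\<close> H] True
          by (simp add: c_def C2_def \<sigma>_def)
      next
        case False
        then have "r > 2" using r by simp
        have p: "conj_exponent r \<noteq> 2" "conj_exponent r > 0" "1 / conj_exponent r = 1 - 1 / r"
          using \<open>r > 2\<close> by (auto simp: conj_exponent_def field_simps)
        have L0: "L \<ge> 0" and SUP_L: "(SUP j. esssup P (\<lambda>\<omega>. ennreal (cmod (\<gamma> j \<omega>)))) = ennreal L"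
          using L \<open>r > 2\<close> by auto
        have bound: "AE \<omega> in P. cmod (\<gamma> j \<omega>) \<le> L" for j
          using esssup_AE[of "\<lambda>\<omega>. ennreal (cmod (\<gamma> j \<omega>))" P]
        proof eventually_elim
          case (elim \<omega>)
          also have "esssup P (\<lambda>\<omega>. ennreal (cmod (\<gamma> j \<omega>))) \<le> ennreal L"
            unfolding SUP_L[symmetric] by (rule SUP_upper) simp
          finally show ?case using L0 by simp
        qed
        have "card {j\<in>{..<K}. cmod (x j) > H * real k powr (1 / r - 1)} < k" if "k \<ge> 1" for k
        proof -
          \<comment> \<open>Entries from \<open>K\<close> on vanish and the threshold is
            nonnegative, so the restriction to \<open>j < K\<close> changes nothing.\<close>
          have "{j\<in>{..<K}. cmod (x j) > H * real k powr (1 / r - 1)}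
              = {j. cmod (x j) > H * real k powr (- (1 / conj_exponent r))}"
            using H x0 by (auto simp: p(3) not_le[symmetric])
          then show ?thesis
            using card_gt_of_weak_lp_norm_less[where H = H, OF B x0 p(2) _ that] norm p(1) by (simp add: S_norm_def)
        qed
        then have "(\<integral>\<^sup>+ \<omega>. ennreal (exp ((\<bar>cmod (\<Sum>j<K. \<gamma> j \<omega> * x j)\<bar>
            / ((L * r + \<sigma> * sqrt (8 * (1 + r / (r - 2)))) * H)) powr r)) \<partial>P) \<le> 18"
          by (rule nn_integral_exp_sum_le_weak[OF indep sub' bound L0 \<open>\<sigma> > 0\<close> H \<open>r > 2\<close>])
        moreover have "L * r + \<sigma> * sqrt (8 * (1 + r / (r - 2))) = c"
          using \<open>r > 2\<close> L0 by (simp add: c_def C_def \<sigma>_def)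
        ultimately show ?thesis unfolding x_eq by simp
      qed
    qed
    then show "luxemburg_norm P r (\<lambda>\<omega>. SUP t::real. cmod (\<Sum>j<K. \<gamma> j \<omega> * D j (\<i> * of_real t)))
          \<le> ennreal ((if r = 2 then 14 * C2 s else 14 * C r s L)
              * (1 + real (prime_counting_set A) * (1 + 20 * ln (real (big_omega_set A)))) powr (1 / r)
              * (SUP t::real. S_norm (conj_exponent r) (\<lambda>j. if j < K then D j (\<i> * of_real t) else 0)))"
      by (simp add: c_def split: if_splits)
  qed
qed

end
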